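(* Every set $S$ of $19$ points in the plane in general position contains two disjoint $5$-holes.
   Context: A finite set of points in the plane is in general position if no three of its points lie on a line. For a finite point set $S$ in the plane in general position, a $k$-hole (empty convex $k$-gon) of $S$ is a subset of $k$ points of $S$ which are the vertices of a convex $k$-gon whose interior contains no points of $S$. Two holes are disjoint if their convex hulls do not intersect. *)

theory Defs
  imports "HOL-Analysis.Analysis"
begin

definition general_position :: "(real^2) set \<Rightarrow> bool" where
  "general_position S \<longleftrightarrow> finite S \<and>
     (\<forall>a\<in>S. \<forall>b\<in>S. \<forall>c\<in>S. a \<noteq> b \<and> a \<noteq> c \<and> b \<noteq> c \<longrightarrow> \<not> collinear {a, b, c})"

(* A convex polygon is a full-dimensional polytope in the plane, regarded as a closed region;
   its vertices are its extreme points. *)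
definition convex_polygon :: "(real^2) set \<Rightarrow> bool" where
  "convex_polygon P \<longleftrightarrow> polytope P \<and> aff_dim P = 2"

definition hole :: "nat \<Rightarrow> (real^2) set \<Rightarrow> (real^2) set \<Rightarrow> bool" where
  "hole k S H \<longleftrightarrow> H \<subseteq> S \<and> card H = k \<and>
     (\<exists>P. convex_polygon P \<and> H = {v. v extreme_point_of P} \<and> interior P \<inter> S = {})"

definition disjoint_holes :: "(real^2) set \<Rightarrow> (real^2) set \<Rightarrow> bool" where
  "disjoint_holes H H' \<longleftrightarrow> convex hull H \<inter> convex hull H' = {}"

end

theory Submission
  imports Defs
begin

text \<open>The proof rests on Harborth's theorem that ten points in general position contain a 5-hole
(\<open>harborth\<close>). Suppose that \<open>S\<close> has no two disjoint 5-holes. Whenever a line leaves ten points of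
\<open>S\<close> on one side, those ten points contain a 5-hole, so the other nine contain none
(\<open>two_holes_if_hole_opposite_ten\<close>). More generally two 5-holes that lie on different sides of a line
through one point of each are disjoint, so no line has 5-holes on both of its sides
(\<open>not_both_left\<close>). The claim is that these prohibitions cannot all be met by nineteen points.

All of this depends only on the orientations of the triples of points. Let \<open>s 0\<close> be a vertex of the
convex hull and let the other points be numbered by angle around it (\<open>fan_exists\<close>). Then the
orientations form a signotope: along the four triples of \<open>a < b < c < d\<close>, listed lexicographically,
the orientation changes at most once (\<open>signotope\<close>). Whether a point lies in a triangle, whether five
points in convex position form a 5-hole, and on which side of a line they lie can each be expressed
by short clauses over the orientations (\<open>triangle_fact\<close>, \<open>pentagon_fact\<close>, \<open>tangent\<close>).

What remains is a propositional contradiction among finitely many instances of these clauses, found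
by clause learning and replayed by the method \<open>argo\<close>. For Harborth's theorem all instances on ten
points are used. For nineteen points there are several hundred thousand instances; explicit
lists name the triangles, the five-point subsets and the separating lines whose instances, together
with all signotope axioms, suffice for a contradiction. Every instance is derived from a proved schema, so the lists are merely hints.\<close>

section \<open>Orientations and half-planes\<close>

definition det3 :: "real^2 \<Rightarrow> real^2 \<Rightarrow> real^2 \<Rightarrow> real" where
  "det3 a b c = (b$1 - a$1) * (c$2 - a$2) - (b$2 - a$2) * (c$1 - a$1)"

lemma det3_swap: "det3 b a c = - det3 a b c" "det3 a c b = - det3 a b c"
  by (simp_all add: det3_def algebra_simps)

lemma det3_rotate: "det3 b c a = det3 a b c"
  by (simp add: det3_def algebra_simps)

lemma det3_same [simp]: "det3 a a b = 0" "det3 a b a = 0" "det3 a b b = 0"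
  by (simp_all add: det3_def)

lemma det3_convex_combination:
  assumes "u + v = 1"
  shows "det3 a b (u *\<^sub>R x + v *\<^sub>R y) = u * det3 a b x + v * det3 a b y"
proof -
  have u: "u = 1 - v" using assms by simp
  show ?thesis unfolding u det3_def by (simp add: algebra_simps)
qed

lemma convex_halfplane_det3: "convex {x. 0 \<le> det3 a b x}"
  by (rule convexI) (simp add: det3_convex_combination)

lemma det3_nonneg_convex_hull:
  assumes "x \<in> convex hull T" and "\<And>w. w \<in> T \<Longrightarrow> 0 \<le> det3 a b w"
  shows "0 \<le> det3 a b x"
  using hull_minimal[of T "{x. 0 \<le> det3 a b x}" convex] convex_halfplane_det3 assms by blast

text \<open>Adjoining a single boundary point keeps an open half-plane convex. Such sets allow a separating line
to pass through one point of each of the two sets that it separates.\<close>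
lemma convex_open_halfplane_insert:
  assumes "det3 a b c = 0"
  shows "convex (insert c {x. 0 < det3 a b x})"
proof (rule convexI)
  fix x y and u v :: real
  assume *: "x \<in> insert c {x. 0 < det3 a b x}" "y \<in> insert c {x. 0 < det3 a b x}"
    "0 \<le> u" "0 \<le> v" "u + v = 1"
  have d: "det3 a b (u *\<^sub>R x + v *\<^sub>R y) = u * det3 a b x + v * det3 a b y"
    using det3_convex_combination * by blast
  have cc: "u *\<^sub>R c + v *\<^sub>R c = c" using * by (metis scaleR_add_left scaleR_one)
  show "u *\<^sub>R x + v *\<^sub>R y \<in> insert c {x. 0 < det3 a b x}"
  proof (cases "u = 0 \<or> v = 0")
    case True then show ?thesis using * by auto
  next
    case False
    then have "u > 0" "v > 0" using * by auto
    then show ?thesis using * d cc assms by (auto simp: add_pos_pos)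
  qed
qed

lemma disjoint_open_halfplanes_insert:
  assumes "det3 a b c = 0" "det3 a b c' = 0" "c \<noteq> c'"
  shows "insert c {x. 0 < det3 a b x} \<inter> insert c' {x. 0 < det3 b a x} = {}"
  using assms by (auto simp: det3_swap(1)[of a b])

lemma disjoint_holes_in_convex_sets:
  assumes "convex K" "convex K'" "K \<inter> K' = {}" "H \<subseteq> K" "H' \<subseteq> K'"
  shows "disjoint_holes H H'"
  using hull_minimal[of H K convex] hull_minimal[of H' K' convex] assms
  unfolding disjoint_holes_def by blast

lemma collinear_if_det3_eq_0:
  assumes "det3 a b c = 0" shows "collinear {a, b, c}"
proof (cases "a = c")
  case False
  then obtain i where i: "a$i \<noteq> c$i" by (auto simp: vec_eq_iff)
  define u where "u = (b$i - c$i) / (a$i - c$i)"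
  have u: "u * (a$i - c$i) = b$i - c$i" using i by (simp add: u_def)
  have "u * (a$j - c$j) = b$j - c$j" for j
  proof -
    have "(b$j - c$j) * (a$i - c$i) = (b$i - c$i) * (a$j - c$j)"
      using assms exhaust_2[of i] exhaust_2[of j] by (auto simp: det3_def algebra_simps)
    then have "(u * (a$j - c$j)) * (a$i - c$i) = (b$j - c$j) * (a$i - c$i)" using u by algebra
    then show ?thesis using i by simp
  qed
  then have "b = u *\<^sub>R a + (1 - u) *\<^sub>R c" by (simp add: vec_eq_iff algebra_simps)
  then show ?thesis unfolding collinear_3_expand by blast
qed (simp add: collinear_3_expand)

lemma general_position_det3:
  assumes "general_position S" "a \<in> S" "b \<in> S" "c \<in> S" "a \<noteq> b" "a \<noteq> c" "b \<noteq> c"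
  shows "det3 a b c \<noteq> 0"
  using assms collinear_if_det3_eq_0 unfolding general_position_def by blast

lemma general_position_subset: "general_position S \<Longrightarrow> T \<subseteq> S \<Longrightarrow> general_position T"
  unfolding general_position_def by (meson finite_subset subsetD)

section \<open>Recognising 5-holes\<close>

definition in_triangle :: "real^2 \<Rightarrow> real^2 \<Rightarrow> real^2 \<Rightarrow> real^2 \<Rightarrow> bool" where
  "in_triangle x a b c \<longleftrightarrow> 0 < det3 a b x \<and> 0 < det3 b c x \<and> 0 < det3 c a x"

text \<open>If all ten triples of \<open>v0, \<dots>, v4\<close> are counterclockwise, each vertex is cut off from the others by
the line through its two neighbours, so the five points are the extreme points of their hull. A
further point of \<open>S\<close> in the hull would be to the left of all five edges, and its position relative to
the two diagonals from \<open>v0\<close> would put it into one of the three triangles of the fan at \<open>v0\<close>.\<close>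
lemma hole_of_empty_fan:
  assumes gp: "general_position S"
    and S: "{v0, v1, v2, v3, v4} \<subseteq> S"
    and c: "0 < det3 v0 v1 v2" "0 < det3 v0 v1 v3" "0 < det3 v0 v1 v4" "0 < det3 v0 v2 v3"
      "0 < det3 v0 v2 v4" "0 < det3 v0 v3 v4" "0 < det3 v1 v2 v3" "0 < det3 v1 v2 v4"
      "0 < det3 v1 v3 v4" "0 < det3 v2 v3 v4"
    and empty: "\<And>x. x \<in> S \<Longrightarrow> \<not> in_triangle x v0 v1 v2" "\<And>x. x \<in> S \<Longrightarrow> \<not> in_triangle x v0 v2 v3"
      "\<And>x. x \<in> S \<Longrightarrow> \<not> in_triangle x v0 v3 v4"
  shows "hole 5 S {v0, v1, v2, v3, v4}"
proof -
  let ?H = "{v0, v1, v2, v3, v4}"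
  have d: "v0 \<noteq> v1" "v0 \<noteq> v2" "v0 \<noteq> v3" "v0 \<noteq> v4" "v1 \<noteq> v2" "v1 \<noteq> v3" "v1 \<noteq> v4" "v2 \<noteq> v3" "v2 \<noteq> v4" "v3 \<noteq> v4"
    using c by auto
  have card: "card ?H = 5" using d by simp
  have rot: "0 < det3 v4 v1 v2" "0 < det3 v4 v1 v3" "0 < det3 v4 v2 v3"  "0 < det3 v3 v0 v1" "0 < det3 v3 v0 v2"
      "0 < det3 v3 v1 v2" "0 < det3 v2 v0 v1" "0 < det3 v3 v4 v0" "0 < det3 v4 v0 v1" "0 < det3 v3 v4 v1" "0 < det3 v3 v4 v2"
      "0 < det3 v4 v0 v2" "0 < det3 v4 v0 v3" "0 < det3 v2 v3 v0" "0 < det3 v2 v3 v1" "0 < det3 v1 v2 v0"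
      "0 < det3 v1 v3 v0" "0 < det3 v2 v4 v0" "0 < det3 v2 v4 v1"
    using c by (metis det3_rotate)+
  have neg: "det3 v4 v1 v0 < 0" "det3 v0 v2 v1 < 0" "det3 v1 v3 v2 < 0" "det3 v2 v4 v3 < 0" "det3 v3 v0 v4 < 0"
    using c rot det3_swap(2)[of v4 v0 v1] det3_swap(2)[of v0 v1 v2] det3_swap(2)[of v1 v2 v3]
      det3_swap(2)[of v2 v3 v4] det3_swap(2)[of v3 v4 v0] by linarith+
  have out: "v \<notin> convex hull T" if "det3 a b v < 0" "\<And>w. w \<in> T \<Longrightarrow> 0 \<le> det3 a b w" for v a b T
    using det3_nonneg_convex_hull[of v T a b] that by force
  have indep: "v \<notin> convex hull (?H - {v})" if "v \<in> ?H" for v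
  proof -
    have "v0 \<notin> convex hull (?H - {v0})" by (rule out[OF neg(1)]) (use d c rot in auto)
    moreover have "v1 \<notin> convex hull (?H - {v1})" by (rule out[OF neg(2)]) (use d c rot in auto)
    moreover have "v2 \<notin> convex hull (?H - {v2})" by (rule out[OF neg(3)]) (use d c rot in auto)
    moreover have "v3 \<notin> convex hull (?H - {v3})" by (rule out[OF neg(4)]) (use d c rot in auto)
    moreover have "v4 \<notin> convex hull (?H - {v4})" by (rule out[OF neg(5)]) (use d c rot in auto)
    ultimately show ?thesis using that by blast
  qed
  have ext: "{v. v extreme_point_of (convex hull ?H)} = ?H"
    using extreme_point_of_convex_hull_convex_independent[OF _ indep] by (auto simp: finite_imp_compact)
  have nocol: "\<not> collinear {v0, v1, v2}"
    using gp S d unfolding general_position_def by simp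
  have "\<not> collinear ?H"
    using nocol collinear_subset[of ?H "{v0, v1, v2}"] by blast
  then have "aff_dim ?H > 1" by (simp add: collinear_aff_dim)
  moreover have "aff_dim ?H \<le> 2" using aff_dim_le_DIM[of ?H] by simp
  ultimately have "aff_dim (convex hull ?H) = 2" by (simp add: aff_dim_convex_hull)
  then have poly: "convex_polygon (convex hull ?H)"
    by (simp add: convex_polygon_def polytope_convex_hull)
  have "x \<notin> interior (convex hull ?H)" if "x \<in> S" for x
  proof (cases "x \<in> ?H")
    case True
    then have "x extreme_point_of (convex hull ?H)" using ext by blast
    then show ?thesis by (rule extreme_point_not_in_interior)
  next
    case False
    have "x \<notin> convex hull ?H"
    proof
      assume x: "x \<in> convex hull ?H"
      have "0 \<le> det3 v0 v1 x" "0 \<le> det3 v1 v2 x" "0 \<le> det3 v2 v3 x" "0 \<le> det3 v3 v4 x" "0 \<le> det3 v4 v0 x"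
        subgoal by (rule det3_nonneg_convex_hull[OF x]) (use c rot in auto)
        subgoal by (rule det3_nonneg_convex_hull[OF x]) (use c rot in auto)
        subgoal by (rule det3_nonneg_convex_hull[OF x]) (use c rot in auto)
        subgoal by (rule det3_nonneg_convex_hull[OF x]) (use c rot in auto)
        subgoal by (rule det3_nonneg_convex_hull[OF x]) (use c rot in auto)
        done
      moreover have nz: "det3 a b x \<noteq> 0" if "a \<in> ?H" "b \<in> ?H" "a \<noteq> b" for a b
        using general_position_det3[OF gp] that S False \<open>x \<in> S\<close> by blast
      then have "det3 v0 v1 x \<noteq> 0" "det3 v1 v2 x \<noteq> 0" "det3 v2 v3 x \<noteq> 0" "det3 v3 v4 x \<noteq> 0" "det3 v4 v0 x \<noteq> 0"
         "det3 v0 v2 x \<noteq> 0" "det3 v0 v3 x \<noteq> 0" using d by auto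
      ultimately show False
        using empty[OF \<open>x \<in> S\<close>] unfolding in_triangle_def det3_swap(1)[of v2 v0] det3_swap(1)[of v3 v0]
        by argo
    qed
    then show ?thesis using interior_subset by blast
  qed
  then have "interior (convex hull ?H) \<inter> S = {}" by blast
  then show ?thesis unfolding hole_def using S card poly ext by (intro conjI exI[of _ "convex hull ?H"]) simp_all
qed

text \<open>A hole of the part of \<open>S\<close> in a convex set is a hole of \<open>S\<close>, because the polygon stays inside the
convex set.\<close>
lemma hole_if_hole_in_convex_part:
  assumes hole: "hole k T H" and "T = S \<inter> K" "convex K"
  shows "hole k S H"
proof -
  obtain P where P: "convex_polygon P" "H = {v. v extreme_point_of P}" "interior P \<inter> T = {}"
    and H: "H \<subseteq> T" "card H = k" using hole unfolding hole_def by blast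
  have "polytope P" using P by (simp add: convex_polygon_def)
  then have "P = convex hull H"
    using Krein_Milman_Minkowski[of P] P by (simp add: polytope_imp_compact polytope_imp_convex)
  then have "P \<subseteq> K" using hull_minimal[of H K convex] H assms by blast
  then have "interior P \<inter> S = {}" using P(3) assms interior_subset[of P] by blast
  then show ?thesis unfolding hole_def using P H assms by blast
qed

section \<open>Radial order around an extreme point\<close>

lemma sorted_list_of_relation:
  assumes "finite A"
    and "\<And>x y z. x \<in> A \<Longrightarrow> y \<in> A \<Longrightarrow> z \<in> A \<Longrightarrow> R x y \<Longrightarrow> R y z \<Longrightarrow> R x z"
    and "\<And>x. x \<in> A \<Longrightarrow> \<not> R x x"
    and "\<And>x y. x \<in> A \<Longrightarrow> y \<in> A \<Longrightarrow> x \<noteq> y \<Longrightarrow> R x y \<or> R y x"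
  shows "\<exists>xs. distinct xs \<and> set xs = A \<and> sorted_wrt R xs"
  using assms
proof (induction A rule: finite_psubset_induct)
  case (psubset A)
  show ?case
  proof (cases "A = {}")
    case False
    have "transp_on A R" by (rule transp_onI) (use psubset.prems(1) in blast)
    moreover have "asymp_on A R" by (rule asymp_onI) (use psubset.prems(1,2) in blast)
    ultimately obtain m where m: "m \<in> A" "\<And>x. x \<in> A \<Longrightarrow> x \<noteq> m \<Longrightarrow> \<not> R x m"
      using Finite_Set.bex_min_element[of A R] False psubset.hyps by blast
    have "A - {m} \<subset> A" using m by blast
    then have "\<exists>xs. distinct xs \<and> set xs = A - {m} \<and> sorted_wrt R xs"
      by (rule psubset.IH) (use psubset.prems in blast)+
    then obtain xs where xs: "distinct xs" "set xs = A - {m}" "sorted_wrt R xs" by blast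
    have "distinct (m # xs) \<and> set (m # xs) = A \<and> sorted_wrt R (m # xs)"
      using xs m(1) m(2) psubset.prems(3) by auto
    then show ?thesis by blast
  qed simp
qed

text \<open>The lexicographically smallest point \<open>p\<close> sees all other points within a half-turn, and therefore
being counterclockwise around \<open>p\<close> is a transitive relation.\<close>
lemma fan_order:
  assumes gp: "general_position S" and "S \<noteq> {}"
  shows "\<exists>p xs. distinct (p # xs) \<and> set (p # xs) = S \<and> sorted_wrt (\<lambda>x y. 0 < det3 p x y) xs"
proof -
  have fin: "finite S" using gp by (simp add: general_position_def)
  obtain m where m: "m \<in> S" "\<And>x. x \<in> S \<Longrightarrow> m$1 \<le> x$1"
    using ex_is_arg_min_if_finite[OF fin \<open>S \<noteq> {}\<close>, of "\<lambda>x. x$1"] by (auto simp: is_arg_min_linorder)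
  let ?T = "{x \<in> S. x$1 = m$1}"
  obtain p where p: "p \<in> ?T" "\<And>x. x \<in> ?T \<Longrightarrow> p$2 \<le> x$2"
    using ex_is_arg_min_if_finite[of ?T "\<lambda>x. x$2"] fin m by (auto simp: is_arg_min_linorder)
  have pS: "p \<in> S" and pm: "p$1 = m$1" using p by auto
  have lex: "p$1 < x$1 \<or> p$1 = x$1 \<and> p$2 < x$2" if "x \<in> S - {p}" for x
  proof -
    have "p$1 \<le> x$1" using m that pm by simp
    moreover have "p$2 < x$2" if "p$1 = x$1"
    proof -
      have "p$2 \<le> x$2" using p(2)[of x] \<open>x \<in> S - {p}\<close> that pm by simp
      moreover have "p$2 \<noteq> x$2" using \<open>x \<in> S - {p}\<close> that by (auto simp: vec_eq_iff forall_2)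
      ultimately show ?thesis by simp
    qed
    ultimately show ?thesis by linarith
  qed
  have "\<exists>xs. distinct xs \<and> set xs = S - {p} \<and> sorted_wrt (\<lambda>x y. 0 < det3 p x y) xs"
  proof (rule sorted_list_of_relation)
    show "finite (S - {p})" using fin by simp
  next
    fix x y assume xy: "x \<in> S - {p}" "y \<in> S - {p}" "x \<noteq> y"
    then have "det3 p x y \<noteq> 0" using general_position_det3[OF gp pS] by blast
    then show "0 < det3 p x y \<or> 0 < det3 p y x" using det3_swap(2)[of p y x] by linarith
  next
    fix x y z assume *: "x \<in> S - {p}" "y \<in> S - {p}" "z \<in> S - {p}" "0 < det3 p x y" "0 < det3 p y z"
    have nz: "det3 p x z \<noteq> 0"
    proof -
      have "x \<noteq> z"
        using * det3_swap(2)[of p x y] by auto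
      then show ?thesis using general_position_det3[OF gp pS] * by blast
    qed
    \<comment> \<open>Cramer's rule for \<open>y - p\<close> in terms of \<open>x - p\<close> and \<open>z - p\<close>, read coordinate by coordinate.\<close>
    have id: "(y$i - p$i) * det3 p x z = det3 p y z * (x$i - p$i) + det3 p x y * (z$i - p$i)" if "i = 1 \<or> i = 2" for i
      using that by (auto simp: det3_def algebra_simps)
    show "0 < det3 p x z"
    proof (cases "p$1 < y$1")
      case True
      have "0 \<le> det3 p y z * (x$1 - p$1) + det3 p x y * (z$1 - p$1)"
        using lex[OF *(1)] lex[OF *(3)] * by (intro add_nonneg_nonneg mult_nonneg_nonneg) auto
      then have "0 \<le> (y$1 - p$1) * det3 p x z" using id[of 1] by simp
      then have "0 \<le> det3 p x z" using True by (simp add: zero_le_mult_iff)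
      then show ?thesis using nz by simp
    next
      case False
      then have y: "y$1 = p$1" "p$2 < y$2" using lex[OF *(2)] by auto
      have "0 < - (y$2 - p$2) * (z$1 - p$1)" using *(5) y by (simp add: det3_def algebra_simps)
      then have "z$1 < p$1" using y by (simp add: zero_less_mult_iff mult_less_0_iff)
      then show ?thesis using lex[OF *(3)] by auto
    qed
  qed simp
  then obtain xs where "distinct xs" "set xs = S - {p}" "sorted_wrt (\<lambda>x y. 0 < det3 p x y) xs" by blast
  then show ?thesis using pS by (intro exI[of _ p] exI[of _ xs]) auto
qed

locale fan =
  fixes S :: "(real^2) set" and s :: "nat \<Rightarrow> real^2" and n :: nat
  assumes gp: "general_position S"
    and bij: "bij_betw s {..<n} S"
    and fan: "\<And>i j. 0 < i \<Longrightarrow> i < j \<Longrightarrow> j < n \<Longrightarrow> 0 < det3 (s 0) (s i) (s j)"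
lemma fan_exists:
  assumes "general_position S" "card S = n" "0 < n"
  shows "\<exists>s. fan S s n"
proof -
  have "S \<noteq> {}" using assms by auto
  then obtain p xs where pxs: "distinct (p # xs)" "set (p # xs) = S" "sorted_wrt (\<lambda>x y. 0 < det3 p x y) xs"
    using fan_order[OF assms(1)] by blast
  have len: "length (p # xs) = n" using pxs assms distinct_card by metis
  have "fan S (nth (p # xs)) n"
  proof
    show "bij_betw ((!) (p # xs)) {..<n} S" using bij_betw_nth[OF pxs(1)] pxs(2) len by blast
    fix i j assume ij: "0 < i" "i < j" "j < n"
    then have "0 < det3 p (xs ! (i - 1)) (xs ! (j - 1))"
      using len by (intro sorted_wrt_nth_less[OF pxs(3)]) auto
    then show "0 < det3 ((p # xs) ! 0) ((p # xs) ! i) ((p # xs) ! j)"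
      using ij by (simp add: nth_Cons')
  qed (rule assms(1))
  then show ?thesis by blast
qed

section \<open>Orientations of radially ordered points\<close>

context fan
begin

definition ccw :: "nat \<Rightarrow> nat \<Rightarrow> nat \<Rightarrow> bool" where
  "ccw i j k \<longleftrightarrow> 0 < det3 (s i) (s j) (s k)"

definition inside :: "nat \<Rightarrow> nat \<Rightarrow> nat \<Rightarrow> nat \<Rightarrow> bool" where
  "inside x a b c \<longleftrightarrow> in_triangle (s x) (s a) (s b) (s c) \<or> in_triangle (s x) (s a) (s c) (s b)"

definition vacant :: "nat \<Rightarrow> nat \<Rightarrow> nat \<Rightarrow> bool" where
  "vacant a b c \<longleftrightarrow> (\<forall>x<n. \<not> inside x a b c)"

definition hole_at :: "nat \<Rightarrow> nat \<Rightarrow> nat \<Rightarrow> nat \<Rightarrow> nat \<Rightarrow> bool" where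
  "hole_at a b c d e \<longleftrightarrow> hole 5 S (s ` {a, b, c, d, e})"

text \<open>The 5-hole may touch the line from \<open>s p\<close> to \<open>s q\<close> in \<open>s p\<close> only.\<close>
definition hole_left :: "nat \<Rightarrow> nat \<Rightarrow> bool" where
  "hole_left p q \<longleftrightarrow> (\<exists>H. hole 5 S H \<and> (\<forall>x\<in>H. x \<noteq> s p \<longrightarrow> 0 < det3 (s p) (s q) x))"

lemma s_in: "i < n \<Longrightarrow> s i \<in> S"
  using bij by (auto simp: bij_betw_def)

lemma s_eq_iff: "i < n \<Longrightarrow> j < n \<Longrightarrow> s i = s j \<longleftrightarrow> i = j"
  using bij by (auto simp: bij_betw_def inj_on_def)

lemma S_cases: "x \<in> S \<Longrightarrow> (\<And>i. i < n \<Longrightarrow> x = s i \<Longrightarrow> P) \<Longrightarrow> P"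
  using bij by (auto simp: bij_betw_def)

lemma ccw_0: "0 < i \<Longrightarrow> i < j \<Longrightarrow> j < n \<Longrightarrow> ccw 0 i j"
  using fan by (simp add: ccw_def)

lemma ccw_rotate: "ccw b c a \<longleftrightarrow> ccw a b c"
  by (simp add: ccw_def det3_rotate)

lemma ccw_swap:
  assumes "a < n" "b < n" "c < n" "a \<noteq> b" "a \<noteq> c" "b \<noteq> c"
  shows "ccw b a c \<longleftrightarrow> \<not> ccw a b c"
  using general_position_det3[OF gp s_in s_in s_in, of a b c] assms
  by (auto simp: ccw_def s_eq_iff det3_swap(1)[of "s b" "s a"])

lemma middle_sign:
  fixes x y z p q r :: real
  assumes "x * p + z * q = y * r" "0 < p" "0 < q" "0 < r"
  shows "0 < x \<Longrightarrow> 0 < z \<Longrightarrow> 0 < y" "\<not> 0 < x \<Longrightarrow> \<not> 0 < z \<Longrightarrow> \<not> 0 < y"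
proof -
  assume "0 < x" "0 < z"
  then have "0 < y * r" using assms by (metis add_pos_pos mult_pos_pos)
  then show "0 < y" using \<open>0 < r\<close> by (simp add: zero_less_mult_iff)
next
  assume "\<not> 0 < x" "\<not> 0 < z"
  then have "x * p \<le> 0" "z * q \<le> 0" using assms by (simp_all add: mult_nonpos_nonneg)
  then have "y * r \<le> 0" using assms by linarith
  then show "\<not> 0 < y" using \<open>0 < r\<close> by (simp add: mult_le_0_iff)
qed

text \<open>At most one change of sign along \<open>a b c\<close>, \<open>a b d\<close>, \<open>a c d\<close>, \<open>b c d\<close>: for any three of these
triples the middle one agrees with one of the outer two.\<close>
definition signotope_fact :: "nat \<Rightarrow> nat \<Rightarrow> nat \<Rightarrow> nat \<Rightarrow> bool" where
  "signotope_fact a b c d \<longleftrightarrow>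
    (\<not> ccw a b c \<or> ccw a b d \<or> \<not> ccw a c d) \<and> (ccw a b c \<or> \<not> ccw a b d \<or> ccw a c d) \<and>
    (\<not> ccw a b c \<or> ccw a b d \<or> \<not> ccw b c d) \<and> (ccw a b c \<or> \<not> ccw a b d \<or> ccw b c d) \<and>
    (\<not> ccw a b c \<or> ccw a c d \<or> \<not> ccw b c d) \<and> (ccw a b c \<or> \<not> ccw a c d \<or> ccw b c d) \<and>
    (\<not> ccw a b d \<or> ccw a c d \<or> \<not> ccw b c d) \<and> (ccw a b d \<or> \<not> ccw a c d \<or> ccw b c d)"

text \<open>For three of the four triples the determinants satisfy a Grassmann--Pluecker relation whose
coefficients are determinants with \<open>s 0\<close>. Those are positive, so the middle determinant is a positive
combination of the outer ones.\<close>
lemma signotope: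
  assumes "a < b" "b < c" "c < d" "d < n"
  shows "signotope_fact a b c d"
proof (cases "a = 0")
  case True
  then show ?thesis using ccw_0 assms by (simp add: signotope_fact_def)
next
  case False
  define w where "w i j = det3 (s 0) (s i) (s j)" for i j
  have w: "0 < w a b" "0 < w a c" "0 < w a d" "0 < w b c" "0 < w b d" "0 < w c d"
    using fan assms False by (auto simp: w_def)
  have "det3 (s a) (s b) (s c) * w a d + det3 (s a) (s c) (s d) * w a b = det3 (s a) (s b) (s d) * w a c"
    "det3 (s a) (s b) (s c) * w b d + det3 (s b) (s c) (s d) * w a b = det3 (s a) (s b) (s d) * w b c"
    "det3 (s a) (s b) (s c) * w c d + det3 (s b) (s c) (s d) * w a c = det3 (s a) (s c) (s d) * w b c"
    "det3 (s a) (s b) (s d) * w c d + det3 (s b) (s c) (s d) * w a d = det3 (s a) (s c) (s d) * w b d"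
    unfolding w_def det3_def by algebra+
  from middle_sign[OF this(1) w(3) w(1) w(2)] middle_sign[OF this(2) w(5) w(1) w(4)]
    middle_sign[OF this(3) w(6) w(2) w(4)] middle_sign[OF this(4) w(6) w(3) w(5)]
  show ?thesis unfolding signotope_fact_def ccw_def by blast
qed

lemma inside_orientation:
  assumes "inside x a b c"
  shows "ccw a b c \<longleftrightarrow> ccw a x c" "ccw a b c \<longleftrightarrow> \<not> ccw a x b" "ccw a b c \<longleftrightarrow> \<not> ccw b x c"
proof -
  have "det3 (s a) (s b) (s c) = det3 (s a) (s b) (s x) + det3 (s b) (s c) (s x) + det3 (s c) (s a) (s x)"
    unfolding det3_def by algebra
  moreover have "det3 (s a) (s x) (s c) = det3 (s c) (s a) (s x)" "det3 (s a) (s x) (s b) = - det3 (s a) (s b) (s x)"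
    "det3 (s b) (s x) (s c) = - det3 (s b) (s c) (s x)"
    "det3 (s a) (s c) (s x) = - det3 (s c) (s a) (s x)" "det3 (s c) (s b) (s x) = - det3 (s b) (s c) (s x)"
    "det3 (s b) (s a) (s x) = - det3 (s a) (s b) (s x)"
    unfolding det3_def by algebra+
  ultimately show "ccw a b c \<longleftrightarrow> ccw a x c" "ccw a b c \<longleftrightarrow> \<not> ccw a x b" "ccw a b c \<longleftrightarrow> \<not> ccw b x c"
    using assms unfolding inside_def in_triangle_def ccw_def by linarith+
qed

text \<open>A point inside a triangle lies in the angle under which \<open>s 0\<close> sees the triangle.\<close>
lemma inside_range:
  assumes "a < b" "b < c" "c < n" "x < n" and ins: "inside x a b c"
  shows "a < x \<and> x < c \<and> x \<noteq> b \<and> (a = 0 \<longrightarrow> b < x)"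
proof -
  have ne: "x \<noteq> a" "x \<noteq> b" "x \<noteq> c"
    using ins by (auto simp: inside_def in_triangle_def)
  note o = inside_orientation[OF ins]
  have o': "ccw a b c \<longleftrightarrow> ccw a b x" "ccw a b c \<longleftrightarrow> ccw b c x" "ccw a b c \<longleftrightarrow> \<not> ccw a c x"
    using o ccw_swap[of x a b] ccw_swap[of x b c] ccw_swap[of x a c] ne assms
    by (simp_all add: ccw_rotate[of a x] ccw_rotate[of b x] ccw_rotate[of a b x] ccw_rotate[of b c x] ccw_rotate[of a c x]
          ccw_rotate[of _ a x] ccw_rotate[of _ b x])
  have "a < x"
  proof (rule ccontr)
    assume "\<not> a < x"
    then have "x < a" using ne by simp
    then have "signotope_fact x a b c" using signotope assms by simp
    moreover have "ccw x a b = ccw a b x" "ccw x b c = ccw b c x" "ccw x a c = ccw a c x" by (simp_all add: ccw_rotate)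
    ultimately show False using o' unfolding signotope_fact_def by argo
  qed
  moreover have "x < c"
  proof (rule ccontr)
    assume "\<not> x < c"
    then have "signotope_fact a b c x" using signotope assms ne by simp
    then show False using o' unfolding signotope_fact_def by argo
  qed
  moreover have "b < x" if "a = 0"
  proof (rule ccontr)
    assume "\<not> b < x"
    then have "x < b" using ne by simp
    then show False using o(2) ccw_0[of x b] ccw_0[of b c] \<open>a < x\<close> assms that by simp
  qed
  ultimately show ?thesis using ne by blast
qed

definition triangle_fact :: "nat \<Rightarrow> nat \<Rightarrow> nat \<Rightarrow> nat \<Rightarrow> bool" where
  "triangle_fact a b c x \<longleftrightarrow>
    (\<not> inside x a b c \<or> \<not> ccw a b c \<or> ccw a x c) \<and> (\<not> inside x a b c \<or> ccw a b c \<or> \<not> ccw a x c) \<and>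
    (if x < b then (\<not> inside x a b c \<or> \<not> ccw a b c \<or> \<not> ccw a x b) \<and> (\<not> inside x a b c \<or> ccw a b c \<or> ccw a x b)
     else (\<not> inside x a b c \<or> \<not> ccw a b c \<or> \<not> ccw b x c) \<and> (\<not> inside x a b c \<or> ccw a b c \<or> ccw b x c))"

lemma triangle_fact: "triangle_fact a b c x"
  using inside_orientation[of x a b c] unfolding triangle_fact_def by argo

lemma vacant_or_inside:
  assumes "a < b" "b < c" "c < n"
  shows "vacant a b c \<or> (\<exists>x\<in>{a<..<c}. x \<noteq> b \<and> (a = 0 \<longrightarrow> b < x) \<and> inside x a b c)"
  using inside_range[OF assms] unfolding vacant_def by (metis greaterThanLessThan_iff)

lemma vacant_in_triangle:
  assumes "vacant a b c" "x \<in> S"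
  shows "\<not> in_triangle x (s a) (s b) (s c)" "\<not> in_triangle x (s a) (s c) (s b)"
  using assms S_cases[of x] unfolding vacant_def inside_def by metis+

definition convex_pentagon :: "nat \<Rightarrow> nat \<Rightarrow> nat \<Rightarrow> nat \<Rightarrow> nat \<Rightarrow> bool" where
  "convex_pentagon a b c d e \<longleftrightarrow> ccw a b c \<and> ccw a b d \<and> ccw a b e \<and> ccw a c d \<and> ccw a c e \<and> ccw a d e \<and>
     ccw b c d \<and> ccw b c e \<and> ccw b d e \<and> ccw c d e"

lemma hole_at_if_convex_pentagon:
  assumes "convex_pentagon a b c d e" "a < n" "b < n" "c < n" "d < n" "e < n"
    and "\<And>x. x \<in> S \<Longrightarrow> \<not> in_triangle x (s a) (s b) (s c)"
    and "\<And>x. x \<in> S \<Longrightarrow> \<not> in_triangle x (s a) (s c) (s d)"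
    and "\<And>x. x \<in> S \<Longrightarrow> \<not> in_triangle x (s a) (s d) (s e)"
    and "{a, b, c, d, e} = {a', b', c', d', e'}"
  shows "hole_at a' b' c' d' e'"
proof -
  have "hole 5 S {s a, s b, s c, s d, s e}"
    by (rule hole_of_empty_fan[OF gp]) (use assms s_in in \<open>auto simp: convex_pentagon_def ccw_def\<close>)
  moreover have "{s a, s b, s c, s d, s e} = s ` {a', b', c', d', e'}"
    unfolding assms(10)[symmetric] by simp
  ultimately show ?thesis by (simp add: hole_at_def)
qed

text \<open>Five points \<open>a < b < c < d < e\<close> are in convex position if and only if the points below the line
\<open>a e\<close> form a convex chain from \<open>a\<close> to \<open>e\<close> and those above it form a concave one. The index \<open>m < 8\<close>
tells by its binary digits which of \<open>b\<close>, \<open>c\<close>, \<open>d\<close> are above the line, the lowest digit being that of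
\<open>b\<close>. The clause for \<open>m\<close> names the turns along both chains and the three triangles that the diagonals
from \<open>a\<close> cut out of the pentagon.\<close>
fun pentagon_fact :: "nat \<Rightarrow> nat \<Rightarrow> nat \<Rightarrow> nat \<Rightarrow> nat \<Rightarrow> nat \<Rightarrow> bool" where
  "pentagon_fact m a b c d e \<longleftrightarrow>
    (if m = 0 then \<not> ccw a b c \<or> \<not> ccw b c d \<or> \<not> ccw c d e \<or> \<not> vacant a b c \<or> \<not> vacant a c d \<or> \<not> vacant a d e
     else if m = 1 then ccw a b e \<or> \<not> ccw a c d \<or> \<not> ccw c d e \<or> \<not> vacant a c d \<or> \<not> vacant a d e \<or> \<not> vacant a b e
     else if m = 2 then ccw a c e \<or> \<not> ccw a b d \<or> \<not> ccw b d e \<or> \<not> vacant a b d \<or> \<not> vacant a d e \<or> \<not> vacant a c e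
     else if m = 3 then ccw a b c \<or> ccw b c e \<or> \<not> ccw a d e \<or> \<not> vacant a d e \<or> \<not> vacant a c e \<or> \<not> vacant a b c
     else if m = 4 then ccw a d e \<or> \<not> ccw a b c \<or> \<not> ccw b c e \<or> \<not> vacant a b c \<or> \<not> vacant a c e \<or> \<not> vacant a d e
     else if m = 5 then ccw a b d \<or> ccw b d e \<or> \<not> ccw a c e \<or> \<not> vacant a c e \<or> \<not> vacant a d e \<or> \<not> vacant a b d
     else if m = 6 then ccw a c d \<or> ccw c d e \<or> \<not> ccw a b e \<or> \<not> vacant a b e \<or> \<not> vacant a d e \<or> \<not> vacant a c d
     else ccw a b c \<or> ccw b c d \<or> ccw c d e \<or> \<not> vacant a d e \<or> \<not> vacant a c d \<or> \<not> vacant a b c)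
    \<or> hole_at a b c d e"

text \<open>The three turns named for \<open>m\<close> determine the orientations of all ten triples by the signotope
axioms.\<close>
lemma pentagon_fact:
  assumes o: "a < b" "b < c" "c < d" "d < e" "e < n"
  shows "pentagon_fact m a b c d e"
proof -
  have sig: "signotope_fact a b c d" "signotope_fact a b c e" "signotope_fact a b d e" "signotope_fact a c d e"
    "signotope_fact b c d e" using signotope o by auto
  have ne: "a < n" "b < n" "c < n" "d < n" using o by auto
  have reo: "ccw x z y \<longleftrightarrow> \<not> ccw x y z" "ccw z y x \<longleftrightarrow> \<not> ccw x y z" "ccw y x z \<longleftrightarrow> \<not> ccw x y z"
     "ccw y z x \<longleftrightarrow> ccw x y z" "ccw z x y \<longleftrightarrow> ccw x y z"
     if "x < y" "y < z" "z < n" for x y z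
    using that ccw_swap[of x y z] ccw_swap[of x z y] ccw_swap[of y z x] ccw_rotate[of x y z] ccw_rotate[of y z x] ccw_rotate[of x z y]
      ccw_rotate[of z y x] by auto
  have l: "a < c" "a < d" "a < e" "b < d" "b < e" "c < e" using o by auto
  note R = reo[OF o(1,2) ne(3)] reo[OF o(1) l(4) ne(4)] reo[OF o(1) l(5) o(5)] reo[OF l(1) o(3) ne(4)]
    reo[OF l(1) l(6) o(5)] reo[OF l(2) o(4) o(5)] reo[OF o(2,3) ne(4)] reo[OF o(2) l(6) o(5)]
    reo[OF l(4) o(4) o(5)] reo[OF o(3,4) o(5)]
  note V = vacant_in_triangle
  note sg = sig[unfolded signotope_fact_def]
  have "hole_at a b c d e" if "convex_pentagon a b c d e" "vacant a b c" "vacant a c d" "vacant a d e"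
    by (rule hole_at_if_convex_pentagon[OF that(1)]) (use ne o V that in auto)
  moreover have "hole_at a b c d e" if "convex_pentagon a c d e b" "vacant a c d" "vacant a d e" "vacant a b e"
    by (rule hole_at_if_convex_pentagon[OF that(1)]) (use ne o V that in auto)
  moreover have "hole_at a b c d e" if "convex_pentagon a b d e c" "vacant a b d" "vacant a d e" "vacant a c e"
    by (rule hole_at_if_convex_pentagon[OF that(1)]) (use ne o V that in auto)
  moreover have "hole_at a b c d e" if "convex_pentagon a d e c b" "vacant a d e" "vacant a c e" "vacant a b c"
    by (rule hole_at_if_convex_pentagon[OF that(1)]) (use ne o V that in auto)
  moreover have "hole_at a b c d e" if "convex_pentagon a b c e d" "vacant a b c" "vacant a c e" "vacant a d e"
    by (rule hole_at_if_convex_pentagon[OF that(1)]) (use ne o V that in auto)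
  moreover have "hole_at a b c d e" if "convex_pentagon a c e d b" "vacant a c e" "vacant a d e" "vacant a b d"
    by (rule hole_at_if_convex_pentagon[OF that(1)]) (use ne o V that in auto)
  moreover have "hole_at a b c d e" if "convex_pentagon a b e d c" "vacant a b e" "vacant a d e" "vacant a c d"
    by (rule hole_at_if_convex_pentagon[OF that(1)]) (use ne o V that in auto)
  moreover have "hole_at a b c d e" if "convex_pentagon a e d c b" "vacant a d e" "vacant a c d" "vacant a b c"
    by (rule hole_at_if_convex_pentagon[OF that(1)]) (use ne o V that in auto)
  moreover have "convex_pentagon a b c d e" if "ccw a b c" "ccw b c d" "ccw c d e"
    unfolding convex_pentagon_def using that sg by sat
  moreover have "convex_pentagon a c d e b" if "\<not> ccw a b e" "ccw a c d" "ccw c d e"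
    unfolding convex_pentagon_def using that sg R by sat
  moreover have "convex_pentagon a b d e c" if "\<not> ccw a c e" "ccw a b d" "ccw b d e"
    unfolding convex_pentagon_def using that sg R by sat
  moreover have "convex_pentagon a d e c b" if "\<not> ccw a b c" "\<not> ccw b c e" "ccw a d e"
    unfolding convex_pentagon_def using that sg R by sat
  moreover have "convex_pentagon a b c e d" if "\<not> ccw a d e" "ccw a b c" "ccw b c e"
    unfolding convex_pentagon_def using that sg R by sat
  moreover have "convex_pentagon a c e d b" if "\<not> ccw a b d" "\<not> ccw b d e" "ccw a c e"
    unfolding convex_pentagon_def using that sg R by sat
  moreover have "convex_pentagon a b e d c" if "\<not> ccw a c d" "\<not> ccw c d e" "ccw a b e"
    unfolding convex_pentagon_def using that sg R by sat
  moreover have "convex_pentagon a e d c b" if "\<not> ccw a b c" "\<not> ccw b c d" "\<not> ccw c d e"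
    unfolding convex_pentagon_def using that sg R by sat
  ultimately show ?thesis unfolding pentagon_fact.simps by argo
qed

end

section \<open>Lists of clause instances\<close>

text \<open>Repeated halving turns a statement about all entries of a list into many theorems about a few
entries each. The propositional prover works on single clauses, and taking them out of one long
conjunction would take time quadratic in its length.\<close>
fun evens :: "'a list \<Rightarrow> 'a list" and odds :: "'a list \<Rightarrow> 'a list" where
  "evens [] = []" | "evens (x # xs) = x # odds xs"
| "odds [] = []" | "odds (x # xs) = evens xs"

lemma list_all_evens: "list_all P xs \<Longrightarrow> list_all P (evens xs)"
  and list_all_odds: "list_all P xs \<Longrightarrow> list_all P (odds xs)"
proof -
  have "list_all P xs \<longrightarrow> list_all P (evens xs) \<and> list_all P (odds xs)" by (induction xs) auto
  then show "list_all P xs \<Longrightarrow> list_all P (evens xs)" "list_all P xs \<Longrightarrow> list_all P (odds xs)" by auto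
qed

lemma list_ex_rules: "list_ex P [] = False" "list_ex P (x # xs) = (P x \<or> list_ex P xs)"
  by auto

definition triples :: "nat \<Rightarrow> nat \<Rightarrow> (nat \<times> nat \<times> nat) list" where
  "triples m n = [(a, b, c). c \<leftarrow> [m..<n], b \<leftarrow> [m..<c], a \<leftarrow> [m..<b]]"
definition quadruples :: "nat \<Rightarrow> nat \<Rightarrow> (nat \<times> nat \<times> nat \<times> nat) list" where
  "quadruples m n = [(a, b, c, d). d \<leftarrow> [m..<n], c \<leftarrow> [m..<d], b \<leftarrow> [m..<c], a \<leftarrow> [m..<b]]"
definition quintuples :: "nat \<Rightarrow> nat \<Rightarrow> (nat \<times> nat \<times> nat \<times> nat \<times> nat) list" where
  "quintuples m n = [(a, b, c, d, e). e \<leftarrow> [m..<n], d \<leftarrow> [m..<e], c \<leftarrow> [m..<d], b \<leftarrow> [m..<c], a \<leftarrow> [m..<b]]"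

context fan
begin

text \<open>The order conditions are part of the clauses, so that each schema holds for arbitrary lists of
indices; on numerals they are decided by rewriting.\<close>
definition signotope_clauses where
  "signotope_clauses = (\<lambda>(a, b, c, d). 0 < a \<and> a < b \<and> b < c \<and> c < d \<and> d < n \<longrightarrow> signotope_fact a b c d)"

definition triangle_clauses where
  "triangle_clauses = (\<lambda>(a, b, c). a < b \<and> b < c \<and> c < n \<longrightarrow>
     (vacant a b c \<or> list_ex (\<lambda>x. if x = b \<or> a = 0 \<and> x < b then False else inside x a b c) [Suc a..<c]) \<and>
     list_all (\<lambda>x. if x = b \<or> a = 0 \<and> x < b then True else triangle_fact a b c x) [Suc a..<c])"

definition pentagon_clauses where
  "pentagon_clauses = (\<lambda>(m, a, b, c, d, e). a < b \<and> b < c \<and> c < d \<and> d < e \<and> e < n \<longrightarrow> pentagon_fact m a b c d e)"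

lemma signotope_list: "list_all signotope_clauses xs"
  by (auto simp: list_all_iff signotope_clauses_def signotope)

lemma triangle_list: "list_all triangle_clauses xs"
proof -
  have "triangle_clauses (a, b, c)" for a b c
    using vacant_or_inside[of a b c] triangle_fact[of a b c]
    unfolding triangle_clauses_def list_all_iff list_ex_iff by fastforce
  then show ?thesis by (auto simp: list_all_iff)
qed

lemma pentagon_list: "list_all pentagon_clauses xs"
  using pentagon_fact by (auto simp: list_all_iff pentagon_clauses_def simp del: pentagon_fact.simps)

lemma upt_rules: "i < j \<Longrightarrow> [i..<j] = i # [Suc i..<j]" "j \<le> i \<Longrightarrow> [i..<j] = []"
  by (simp_all add: upt_conv_Cons)

lemmas numeral_rules = rel_simps arith_simps zero_neq_one one_neq_zero One_nat_def[symmetric] Suc_numeral Suc_1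
  one_less_numeral_iff numeral_less_iff zero_less_numeral zero_less_one not_less_zero

text \<open>One equation for each \<open>m\<close> spares the rewriting of all eight branches at each instance.\<close>
lemmas pentagon_rules =
  pentagon_fact.simps[of 0, simplified simp_thms if_True if_False numeral_rules disj_assoc]
  pentagon_fact.simps[of 1, simplified simp_thms if_True if_False numeral_rules disj_assoc]
  pentagon_fact.simps[of 2, simplified simp_thms if_True if_False numeral_rules disj_assoc]
  pentagon_fact.simps[of 3, simplified simp_thms if_True if_False numeral_rules disj_assoc]
  pentagon_fact.simps[of 4, simplified simp_thms if_True if_False numeral_rules disj_assoc]
  pentagon_fact.simps[of 5, simplified simp_thms if_True if_False numeral_rules disj_assoc]
  pentagon_fact.simps[of 6, simplified simp_thms if_True if_False numeral_rules disj_assoc]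
  pentagon_fact.simps[of 7, simplified simp_thms if_True if_False numeral_rules disj_assoc]

lemmas clause_rules =
  list.pred_inject list_ex_rules prod.case upt_rules
  simp_thms if_True if_False numeral_rules ccw_0
  signotope_clauses_def signotope_fact_def triangle_clauses_def triangle_fact_def pentagon_clauses_def pentagon_rules

lemmas split_rules = evens.simps odds.simps

lemmas list_rules =
  upt_rules list.map concat.simps append.simps append_Nil2 simp_thms if_True if_False numeral_rules

end

section \<open>Ten points contain a 5-hole\<close>

declare [[argo_timeout = 4000]]

lemma harborth_fan:
  assumes "fan S s 10"
  shows "\<exists>H. hole 5 S H"
proof (rule ccontr)
  assume no: "\<not> ?thesis"
  interpret fan S s 10 by fact
  have none: "hole_at a b c d e = False" for a b c d e using no by (auto simp: hole_at_def)
  note quad0 = signotope_list[of "quadruples 1 10", unfolded quadruples_def, simplified list_rules]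
  note quad1 =
    quad0[THEN list_all_evens, simplified split_rules] quad0[THEN list_all_odds, simplified split_rules]
  note quad2 =
    quad1[THEN list_all_evens, simplified split_rules] quad1[THEN list_all_odds, simplified split_rules]
  note quad3 =
    quad2[THEN list_all_evens, simplified split_rules] quad2[THEN list_all_odds, simplified split_rules]
  note quad4 =
    quad3[THEN list_all_evens, simplified split_rules] quad3[THEN list_all_odds, simplified split_rules]
  note quad5 =
    quad4[THEN list_all_evens, simplified split_rules] quad4[THEN list_all_odds, simplified split_rules]
  note quads = quad5[simplified clause_rules]
  note tri0 = triangle_list[of "triples 0 10", unfolded triples_def, simplified list_rules]
  note tri1 =
    tri0[THEN list_all_evens, simplified split_rules] tri0[THEN list_all_odds, simplified split_rules]
  note tri2 =
    tri1[THEN list_all_evens, simplified split_rules] tri1[THEN list_all_odds, simplified split_rules]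
  note tri3 =
    tri2[THEN list_all_evens, simplified split_rules] tri2[THEN list_all_odds, simplified split_rules]
  note tri4 =
    tri3[THEN list_all_evens, simplified split_rules] tri3[THEN list_all_odds, simplified split_rules]
  note tri5 =
    tri4[THEN list_all_evens, simplified split_rules] tri4[THEN list_all_odds, simplified split_rules]
  note tris = tri5[simplified clause_rules]
  note pen0 = pentagon_list
    [of "concat (map (\<lambda>t. map (\<lambda>m. (m, t)) [0..<8]) (quintuples 0 10))", unfolded quintuples_def,
      simplified list_rules]
  note pen1 =
    pen0[THEN list_all_evens, simplified split_rules] pen0[THEN list_all_odds, simplified split_rules]
  note pen2 =
    pen1[THEN list_all_evens, simplified split_rules] pen1[THEN list_all_odds, simplified split_rules]
  note pen3 =
    pen2[THEN list_all_evens, simplified split_rules] pen2[THEN list_all_odds, simplified split_rules]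
  note pen4 =
    pen3[THEN list_all_evens, simplified split_rules] pen3[THEN list_all_odds, simplified split_rules]
  note pen5 =
    pen4[THEN list_all_evens, simplified split_rules] pen4[THEN list_all_odds, simplified split_rules]
  note pen6 =
    pen5[THEN list_all_evens, simplified split_rules] pen5[THEN list_all_odds, simplified split_rules]
  note pen7 =
    pen6[THEN list_all_evens, simplified split_rules] pen6[THEN list_all_odds, simplified split_rules]
  note pen8 =
    pen7[THEN list_all_evens, simplified split_rules] pen7[THEN list_all_odds, simplified split_rules]
  note pens = pen8[simplified clause_rules none]
  show False using quads tris pens by argo
qed

theorem harborth:
  assumes "general_position S" "card S = 10"
  shows "\<exists>H. hole 5 S H"
  using fan_exists[OF assms] harborth_fan by auto

section \<open>Lines that separate 5-holes\<close>

lemma two_holes_if_hole_opposite_ten: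
  assumes "general_position S" and K: "convex K" "convex K'" "K \<inter> K' = {}"
    and "card (S \<inter> K') = 10" and H: "hole 5 S H" "H \<subseteq> K"
  shows "\<exists>H H'. hole 5 S H \<and> hole 5 S H' \<and> disjoint_holes H H'"
proof -
  obtain H' where H': "hole 5 (S \<inter> K') H'"
    using harborth[of "S \<inter> K'"] general_position_subset[OF assms(1)] assms by blast
  then have "H' \<subseteq> K'" by (auto simp: hole_def)
  then show ?thesis
    using hole_if_hole_in_convex_part[OF H' refl K(2)] disjoint_holes_in_convex_sets[OF K H(2)] H(1) by blast
qed

text \<open>The line through \<open>s p\<close> and \<open>s q\<close> splits the indices into \<open>I\<close> and \<open>J\<close>, and one of its two points
goes to each part.\<close>
lemma (in fan) no_hole_opposite_ten:
  assumes none: "\<not> (\<exists>H H'. hole 5 S H \<and> hole 5 S H' \<and> disjoint_holes H H')"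
    and IJ: "I \<union> J = {..<n}" "I \<inter> J = {}" "card J = 10" "k \<in> I" "l \<in> J"
    and pq: "{p, q} = {k, l}"
    and I: "\<And>i. i \<in> I \<Longrightarrow> i \<noteq> k \<Longrightarrow> ccw p q i" and J: "\<And>j. j \<in> J \<Longrightarrow> j \<noteq> l \<Longrightarrow> ccw q p j"
    and t: "{a, b, c, d, e} \<subseteq> I"
  shows "\<not> hole_at a b c d e"
proof
  assume hole: "hole_at a b c d e"
  let ?K = "insert (s k) {x. 0 < det3 (s p) (s q) x}" and ?K' = "insert (s l) {x. 0 < det3 (s q) (s p) x}"
  have z: "det3 (s p) (s q) (s k) = 0" "det3 (s p) (s q) (s l) = 0" "det3 (s q) (s p) (s l) = 0"
    using pq by (auto simp: doubleton_eq_iff)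
  have kl: "s k \<noteq> s l" using IJ s_eq_iff[of k l] by blast
  have disj: "?K \<inter> ?K' = {}" by (rule disjoint_open_halfplanes_insert[OF z(1,2) kl])
  have IK: "s ` I \<subseteq> ?K" and JK: "s ` J \<subseteq> ?K'" using I J unfolding ccw_def by blast+
  have "S = s ` (I \<union> J)" using bij IJ(1) by (simp add: bij_betw_def)
  then have "S \<inter> ?K' = s ` J" using IK JK disj by blast
  moreover have "inj_on s J" using bij IJ(1) by (metis Un_upper2 bij_betw_def inj_on_subset)
  ultimately have "card (S \<inter> ?K') = 10" using IJ(3) by (simp add: card_image)
  moreover have "s ` {a, b, c, d, e} \<subseteq> ?K" using IK t by blast
  ultimately show False
    using two_holes_if_hole_opposite_ten[OF gp convex_open_halfplane_insert[OF z(1)]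
      convex_open_halfplane_insert[OF z(3)] disj] hole none unfolding hole_at_def by blast
qed

text \<open>The lines from \<open>s 0\<close> to \<open>s 9\<close> and from \<open>s 0\<close> to \<open>s 10\<close>, turned slightly so that each of their two
points falls on a side of choice, cut off four sets of nine points from the remaining ten.\<close>
lemma (in fan) no_hole_in_window:
  assumes none: "\<not> (\<exists>H H'. hole 5 S H \<and> hole 5 S H' \<and> disjoint_holes H H')" and n: "n = 19"
    and o: "a < b" "b < c" "c < d" "d < e" "e < 19"
    and w: "e < 9 \<or> 0 < a \<and> e < 10 \<or> 9 < a \<or> a = 0 \<and> 10 < b"
  shows "hole_at a b c d e = False"
proof -
  have le: "ccw k 0 i" if "0 < i" "i < k" "k < 19" for i k using ccw_0[of i k] that n ccw_rotate by blast
  have gr: "ccw 0 k i" if "0 < k" "k < i" "i < 19" for i k using ccw_0[of k i] that n by blast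
  note N = no_hole_opposite_ten[OF none, unfolded n]
  have "\<not> hole_at a b c d e"
    using w
  proof (elim disjE)
    assume "e < 9"
    show ?thesis
      by (rule N[of "{0..<9}" "{9..<19}" 0 9 9 0]) (use le gr o \<open>e < 9\<close> in auto)
  next
    assume *: "0 < a \<and> e < 10"
    show ?thesis
      by (rule N[of "{1..<10}" "insert 0 {10..<19}" 9 0 9 0]) (use le gr o * in auto)
  next
    assume *: "9 < a"
    show ?thesis
      by (rule N[of "{10..<19}" "{0..<10}" 10 0 0 10]) (use le gr o * in auto)
  next
    assume *: "a = 0 \<and> 10 < b"
    show ?thesis
      by (rule N[of "insert 0 {11..<19}" "{1..<11}" 0 10 0 10]) (use le gr o * in auto)
  qed
  then show ?thesis by simp
qed

lemma (in fan) tangent: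
  assumes "hole_at a b c d e" "\<And>x. x \<in> {a, b, c, d, e} \<Longrightarrow> x \<noteq> p \<Longrightarrow> ccw p q x"
  shows "hole_left p q"
  using assms unfolding hole_left_def hole_at_def ccw_def by blast

lemma (in fan) not_both_left:
  assumes none: "\<not> (\<exists>H H'. hole 5 S H \<and> hole 5 S H' \<and> disjoint_holes H H')"
    and "p < n" "q < n" "p \<noteq> q"
  shows "\<not> hole_left p q \<or> \<not> hole_left q p"
proof (rule ccontr)
  assume "\<not> ?thesis"
  then obtain H H' where H: "hole 5 S H" "\<And>x. x \<in> H \<Longrightarrow> x \<noteq> s p \<Longrightarrow> 0 < det3 (s p) (s q) x"
    and H': "hole 5 S H'" "\<And>x. x \<in> H' \<Longrightarrow> x \<noteq> s q \<Longrightarrow> 0 < det3 (s q) (s p) x"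
    unfolding hole_left_def by blast
  have z: "det3 (s p) (s q) (s p) = 0" "det3 (s q) (s p) (s q) = 0" "det3 (s p) (s q) (s q) = 0"
    by simp_all
  have "s p \<noteq> s q" using s_eq_iff assms(2-4) by blast
  then have "disjoint_holes H H'"
    by (intro disjoint_holes_in_convex_sets[OF convex_open_halfplane_insert[OF z(1)]
          convex_open_halfplane_insert[OF z(2)] disjoint_open_halfplanes_insert[OF z(1,3)]])
      (use H H' in blast)+
  then show False using none H H' by blast
qed

text \<open>Only the atoms \<open>ccw i j k\<close> with \<open>i < j < k\<close> occur in the clauses; this is \<open>ccw\<close> in terms of them.\<close>
definition (in fan) sorted_ccw :: "nat \<Rightarrow> nat \<Rightarrow> nat \<Rightarrow> bool" where
  "sorted_ccw a b c \<longleftrightarrow>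
    (if a < b then if b < c then ccw a b c else if a < c then \<not> ccw a c b else ccw c a b
     else if a < c then \<not> ccw b a c else if b < c then ccw b c a else \<not> ccw c b a)"

lemma (in fan) sorted_ccw:
  assumes "a < n" "b < n" "c < n" "a \<noteq> b" "a \<noteq> c" "b \<noteq> c"
  shows "sorted_ccw a b c \<longleftrightarrow> ccw a b c"
  using assms ccw_swap[of a b c] ccw_swap[of a c b] ccw_swap[of b c a] ccw_rotate[of a b c] ccw_rotate[of b c a]
    ccw_rotate[of a c b] ccw_rotate[of c b a]
  unfolding sorted_ccw_def by auto

section \<open>Nineteen points contain two disjoint 5-holes\<close>

context fan
begin

text \<open>The point \<open>p\<close> of the line itself counts as lying to the left, which matches \<open>hole_left\<close>.\<close>
definition left_or_first where
  "left_or_first p q x \<longleftrightarrow> (if x = p then True else sorted_ccw p q x)"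

text \<open>An entry consists of five points, the shapes \<open>m\<close> in which they are considered as a convex pentagon,
and the lines \<open>(p, q)\<close> that are to have the resulting hole on their left.\<close>
definition certificate_clauses where
  "certificate_clauses = (\<lambda>(a, b, c, d, e, ms, lines). a < b \<and> b < c \<and> c < d \<and> d < e \<and> e < n \<longrightarrow>
     list_all (\<lambda>m. pentagon_fact m a b c d e) ms \<and>
     list_all (\<lambda>(p, q). p < n \<and> q < n \<and> p \<noteq> q \<and> q \<noteq> a \<and> q \<noteq> b \<and> q \<noteq> c \<and> q \<noteq> d \<and> q \<noteq> e \<longrightarrow>
       \<not> hole_at a b c d e \<or> \<not> left_or_first p q a \<or> \<not> left_or_first p q b \<or> \<not> left_or_first p q c \<or>
       \<not> left_or_first p q d \<or> \<not> left_or_first p q e \<or> hole_left p q) lines)"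

lemma certificate_list: "list_all certificate_clauses xs"
proof -
  have "hole_left p q" if "a < b" "b < c" "c < d" "d < e" "e < n" "p < n" "q < n" "p \<noteq> q" "q \<notin> {a, b, c, d, e}"
    "hole_at a b c d e" "\<forall>x\<in>{a, b, c, d, e}. left_or_first p q x" for a b c d e p q
  proof (rule tangent[OF that(10)])
    fix x assume "x \<in> {a, b, c, d, e}" "x \<noteq> p"
    then show "ccw p q x" using that sorted_ccw[of p q x] unfolding left_or_first_def by auto
  qed
  then show ?thesis
    using pentagon_fact by (auto simp: list_all_iff certificate_clauses_def simp del: pentagon_fact.simps)
qed

definition separation_clauses where
  "separation_clauses = (\<lambda>(p, q). p < n \<and> q < n \<and> p \<noteq> q \<longrightarrow> \<not> hole_left p q \<or> \<not> hole_left q p)"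

end

text \<open>The lists were obtained by running a clause-learning solver on the full set of instances and
keeping what its refutation used. The triangles are those cut out of the listed pentagons by the
diagonals from their first point.\<close>
lemma two_disjoint_holes_fan:
  assumes "fan S s 19"
  shows "\<exists>H H'. hole 5 S H \<and> hole 5 S H' \<and> disjoint_holes H H'"
proof (rule ccontr)
  assume none: "\<not> ?thesis"
  interpret fan S s 19 by fact
  note windows = no_hole_in_window[OF none refl]
  have separation_list: "list_all separation_clauses xs" for xs
    using not_both_left[OF none] by (auto simp: list_all_iff separation_clauses_def)
  note quad0 = signotope_list[of "quadruples 1 19", unfolded quadruples_def, simplified list_rules]
  note quad1 =
    quad0[THEN list_all_evens, simplified split_rules] quad0[THEN list_all_odds, simplified split_rules]
  note quad2 =
    quad1[THEN list_all_evens, simplified split_rules] quad1[THEN list_all_odds, simplified split_rules]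
  note quad3 =
    quad2[THEN list_all_evens, simplified split_rules] quad2[THEN list_all_odds, simplified split_rules]
  note quad4 =
    quad3[THEN list_all_evens, simplified split_rules] quad3[THEN list_all_odds, simplified split_rules]
  note quad5 =
    quad4[THEN list_all_evens, simplified split_rules] quad4[THEN list_all_odds, simplified split_rules]
  note quad6 =
    quad5[THEN list_all_evens, simplified split_rules] quad5[THEN list_all_odds, simplified split_rules]
  note quad7 =
    quad6[THEN list_all_evens, simplified split_rules] quad6[THEN list_all_odds, simplified split_rules]
  note quad8 =
    quad7[THEN list_all_evens, simplified split_rules] quad7[THEN list_all_odds, simplified split_rules]
  note quad9 =
    quad8[THEN list_all_evens, simplified split_rules] quad8[THEN list_all_odds, simplified split_rules]
  note quad10 =
    quad9[THEN list_all_evens, simplified split_rules] quad9[THEN list_all_odds, simplified split_rules]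
  note quad11 =
    quad10[THEN list_all_evens, simplified split_rules] quad10[THEN list_all_odds, simplified split_rules]
  note quads = quad11[simplified clause_rules]
  note tri0 = triangle_list[of "[
    (0,1,2), (0,1,3), (0,1,4), (0,1,9), (0,1,10), (0,1,11), (0,1,12), (0,1,13), (0,1,14),
    (0,2,3), (0,2,4), (0,2,5), (0,2,9), (0,2,10), (0,2,11), (0,2,12), (0,2,13), (0,2,14),
    (0,3,4), (0,3,5), (0,3,6), (0,3,9), (0,3,10), (0,3,11), (0,3,12), (0,3,13), (0,4,5),
    (0,4,6), (0,4,7), (0,4,9), (0,4,10), (0,4,11), (0,4,12), (0,4,13), (0,5,6), (0,5,7),
    (0,5,8), (0,5,9), (0,5,10), (0,5,11), (0,5,12), (0,5,13), (0,5,15), (0,6,7), (0,6,8),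
    (0,6,9), (0,6,10), (0,6,11), (0,6,12), (0,6,13), (0,6,14), (0,6,15), (0,7,8), (0,7,9),
    (0,7,10), (0,7,11), (0,8,10), (0,9,10), (0,9,11), (0,9,12), (0,9,13), (0,9,14), (0,10,11),
    (0,10,12), (0,10,13), (0,10,14), (0,10,15), (0,11,12), (0,11,13), (0,11,14), (0,12,13),
    (0,12,14), (0,12,15), (0,13,14), (0,13,15), (0,13,16), (0,14,15), (0,14,16), (0,14,17),
    (0,15,16), (0,15,17), (0,15,18), (0,16,17), (0,16,18), (0,17,18), (1,2,3), (1,2,4), (1,2,5),
    (1,2,6), (1,2,7), (1,2,8), (1,2,9), (1,2,10), (1,3,4), (1,3,5), (1,3,6), (1,3,7), (1,3,8),
    (1,3,9), (1,3,10), (1,4,5), (1,4,6), (1,4,7), (1,4,8), (1,4,9), (1,4,10), (1,4,11), (1,5,6),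
    (1,5,7), (1,5,8), (1,5,9), (1,5,10), (1,5,11), (1,6,7), (1,6,8), (1,6,9), (1,6,10),
    (1,6,11), (1,6,18), (1,7,8), (1,7,9), (1,7,10), (1,7,11), (1,8,9), (1,8,10), (1,8,11),
    (1,8,12), (1,8,18), (1,9,10), (1,9,11), (1,9,12), (1,9,13), (1,9,14), (1,9,18), (1,10,11),
    (1,11,12), (1,11,17), (1,11,18), (1,12,14), (1,12,15), (1,13,15), (1,17,18), (2,3,4),
    (2,3,5), (2,3,6), (2,3,7), (2,3,8), (2,3,9), (2,3,10), (2,3,11), (2,4,5), (2,4,6), (2,4,7),
    (2,4,8), (2,4,9), (2,4,10), (2,4,11), (2,5,6), (2,5,7), (2,5,8), (2,5,9), (2,5,10),
    (2,5,11), (2,6,7), (2,6,8), (2,6,9), (2,6,10), (2,6,11), (2,7,8), (2,7,9), (2,7,10),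
    (2,7,11), (2,8,9), (2,8,10), (2,8,11), (2,8,14), (2,8,18), (2,9,11), (2,9,18), (2,10,11),
    (3,4,5), (3,4,6), (3,4,7), (3,4,8), (3,4,9), (3,4,10), (3,4,11), (3,5,6), (3,5,7), (3,5,8),
    (3,5,9), (3,5,10), (3,5,11), (3,5,12), (3,5,13), (3,6,7), (3,6,8), (3,6,9), (3,6,10),
    (3,6,11), (3,6,18), (3,7,8), (3,7,9), (3,7,10), (3,7,11), (3,7,12), (3,8,9), (3,8,10),
    (3,8,11), (3,8,18), (3,9,10), (3,9,11), (3,9,13), (3,9,14), (3,9,18), (3,10,11), (3,10,12),
    (3,11,12), (3,12,13), (3,12,14), (3,12,15), (3,13,14), (3,13,15), (3,14,15), (4,5,6),
    (4,5,7), (4,5,8), (4,5,9), (4,5,10), (4,5,11), (4,6,7), (4,6,8), (4,6,9), (4,6,10),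
    (4,6,11), (4,6,13), (4,6,18), (4,7,8), (4,7,9), (4,7,10), (4,7,11), (4,7,12), (4,8,9),
    (4,8,10), (4,8,11), (4,8,14), (4,8,18), (4,9,10), (4,9,11), (4,9,12), (4,9,13), (4,9,14),
    (4,9,18), (4,10,11), (4,10,12), (4,10,13), (4,11,12), (4,11,13), (4,12,13), (4,12,14),
    (4,12,15), (4,13,14), (4,13,15), (4,14,15), (5,6,7), (5,6,8), (5,6,9), (5,6,10), (5,6,11),
    (5,6,18), (5,7,8), (5,7,9), (5,7,10), (5,7,11), (5,7,12), (5,8,9), (5,8,10), (5,8,11),
    (5,8,18), (5,9,10), (5,9,11), (5,9,13), (5,9,14), (5,9,18), (5,10,11), (5,10,12), (5,10,13),
    (5,11,12), (5,11,13), (5,12,13), (5,12,15), (5,14,15), (6,7,8), (6,7,9), (6,7,10), (6,7,11),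
    (6,8,9), (6,8,10), (6,8,11), (6,8,12), (6,8,18), (6,9,10), (6,9,11), (6,9,12), (6,9,14),
    (6,9,18), (6,10,11), (6,10,12), (6,11,12), (6,11,13), (6,12,13), (6,12,15), (6,13,15),
    (6,14,15), (7,8,9), (7,8,10), (7,8,11), (7,8,14), (7,8,18), (7,9,10), (7,9,11), (7,9,12),
    (7,9,13), (7,10,11), (7,10,12), (7,11,12), (7,11,13), (7,11,18), (7,12,13), (7,12,14),
    (8,9,11), (8,9,14), (8,10,11), (8,11,12), (8,11,13), (8,12,13), (8,12,14), (8,12,18),
    (8,13,14), (8,13,15), (8,13,17), (8,13,18), (8,14,15), (8,14,16), (8,14,17), (8,17,18),
    (9,11,12), (9,11,13), (9,11,14), (9,12,13), (9,12,14), (9,12,15), (9,12,16), (9,13,14),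
    (9,13,15), (9,13,16), (9,13,17), (9,13,18), (9,14,15), (9,14,16), (9,14,17), (9,14,18),
    (9,15,16), (9,15,17), (9,15,18), (9,16,18), (9,17,18), (10,11,12), (10,11,13), (10,11,14),
    (10,11,15), (10,11,16), (10,11,17), (10,11,18), (10,12,13), (10,12,14), (10,12,15),
    (10,12,16), (10,12,17), (10,13,14), (10,13,15), (10,13,16), (10,13,17), (10,13,18),
    (10,14,15), (10,14,16), (10,14,17), (10,14,18), (10,15,16), (10,15,17), (10,15,18),
    (10,16,17), (10,16,18), (10,17,18), (11,12,13), (11,12,14), (11,12,15), (11,12,16),
    (11,12,17), (11,12,18), (11,13,14), (11,13,15), (11,13,16), (11,13,17), (11,13,18),
    (11,14,15), (11,14,16), (11,14,17), (11,14,18), (11,15,16), (11,15,17), (11,15,18),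
    (11,16,17), (11,16,18), (11,17,18), (12,13,14), (12,13,15), (12,13,16), (12,13,17),
    (12,13,18), (12,14,15), (12,14,16), (12,14,17), (12,14,18), (12,15,16), (12,15,17),
    (12,15,18), (12,16,17), (12,16,18), (12,17,18), (13,14,15), (13,14,16), (13,14,17),
    (13,14,18), (13,15,16), (13,15,17), (13,15,18), (13,16,17), (13,16,18), (13,17,18),
    (14,15,16), (14,15,17), (14,15,18), (14,16,17), (14,16,18), (14,17,18)
  ]"]
  note tri1 =
    tri0[THEN list_all_evens, simplified split_rules] tri0[THEN list_all_odds, simplified split_rules]
  note tri2 =
    tri1[THEN list_all_evens, simplified split_rules] tri1[THEN list_all_odds, simplified split_rules]
  note tri3 =
    tri2[THEN list_all_evens, simplified split_rules] tri2[THEN list_all_odds, simplified split_rules]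
  note tri4 =
    tri3[THEN list_all_evens, simplified split_rules] tri3[THEN list_all_odds, simplified split_rules]
  note tri5 =
    tri4[THEN list_all_evens, simplified split_rules] tri4[THEN list_all_odds, simplified split_rules]
  note tri6 =
    tri5[THEN list_all_evens, simplified split_rules] tri5[THEN list_all_odds, simplified split_rules]
  note tri7 =
    tri6[THEN list_all_evens, simplified split_rules] tri6[THEN list_all_odds, simplified split_rules]
  note tri8 =
    tri7[THEN list_all_evens, simplified split_rules] tri7[THEN list_all_odds, simplified split_rules]
  note tris = tri8[simplified clause_rules]
  note pen0 = certificate_list[of "[
    (0,1,2,3,4,[0],[]), (0,1,2,3,5,[0],[]), (0,1,2,3,6,[0],[]),
    (0,1,2,3,9,[0],[(1,5),(1,6),(1,10),(1,12),(2,5),(2,10),(2,12),(3,10),(3,11),(3,12)]),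
    (0,1,2,3,10,[0],[(3,9),(3,11),(3,12)]), (0,1,2,3,12,[0],[(3,9)]), (0,1,2,4,5,[0],[]),
    (0,1,2,4,6,[0],[]), (0,1,2,4,7,[0],[]), (0,1,2,4,9,[0],[(4,10),(4,12)]),
    (0,1,2,4,12,[0],[(4,9)]), (0,1,2,4,13,[0],[(4,9)]), (0,1,2,5,7,[0],[]),
    (0,1,2,9,13,[0],[(2,12)]), (0,1,2,10,12,[0],[(2,11)]), (0,1,2,10,13,[0],[(2,11)]),
    (0,1,2,11,12,[0],[(2,9),(2,10)]), (0,1,2,12,13,[0],[(2,9),(2,11)]),
    (0,1,2,12,14,[0],[(2,11)]), (0,1,3,4,5,[0],[]), (0,1,3,4,6,[0],[]),
    (0,1,3,4,9,[0],[(4,10)]), (0,1,3,5,6,[0],[]), (0,1,3,5,7,[0],[]), (0,1,3,5,8,[0],[]),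
    (0,1,3,5,9,[0],[(5,10)]), (0,1,3,5,10,[0],[(5,11),(5,12),(5,13)]), (0,1,3,6,8,[0],[]),
    (0,1,3,6,9,[0],[(6,10)]), (0,1,3,10,13,[0],[(3,11)]),
    (0,1,3,12,13,[0],[(3,9),(3,10),(3,11)]), (0,1,3,12,14,[0],[(3,9),(3,10),(3,11),(3,13)]),
    (0,1,3,13,14,[0],[(3,12)]), (0,1,3,13,15,[0],[(3,12)]), (0,1,3,13,16,[0],[(3,12)]),
    (0,1,4,5,6,[0],[]), (0,1,4,6,8,[0],[]), (0,1,4,6,9,[0],[(6,10),(6,11)]),
    (0,1,4,11,12,[0],[(4,10)]), (0,1,4,12,13,[0],[(4,11)]), (0,1,4,12,14,[0],[(4,11)]),
    (0,1,9,12,13,[0],[(9,11)]), (0,1,9,12,14,[0],[(1,11),(9,11)]), (0,1,9,13,16,[0],[(1,11)]),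
    (0,1,10,12,13,[0],[(10,11)]), (0,1,10,12,14,[0],[(10,11)]), (0,1,11,12,13,[0],[(1,10)]),
    (0,1,12,13,14,[0],[(1,11)]), (0,1,12,14,16,[0],[(1,11)]), (0,1,12,14,17,[0],[(1,11)]),
    (0,1,12,15,17,[0],[(1,11)]), (0,1,13,14,15,[0],[(1,11)]), (0,1,13,14,16,[0],[(1,11)]),
    (0,1,14,16,18,[0],[(1,11)]), (0,2,3,4,5,[0],[]), (0,2,3,4,6,[0],[]), (0,2,3,4,7,[0],[]),
    (0,2,3,4,9,[0],[(3,6),(3,7),(3,10),(3,12),(4,10),(4,11),(4,12),(4,13)]),
    (0,2,3,4,10,[0],[(4,9),(4,11),(4,12),(4,13)]), (0,2,3,4,12,[0],[(4,9)]),
    (0,2,3,4,13,[0],[(4,9)]), (0,2,3,5,6,[0],[]), (0,2,3,5,7,[0],[]),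
    (0,2,3,5,9,[0],[(3,7),(3,10),(3,12),(3,13),(5,10),(5,12),(5,13)]),
    (0,2,3,5,10,[0],[(5,9),(5,11),(5,12)]), (0,2,3,9,13,[0],[(3,12)]),
    (0,2,3,11,12,[0],[(3,9)]), (0,2,3,12,13,[0],[(3,9),(3,11)]),
    (0,2,3,12,14,[0],[(3,9),(3,11)]), (0,2,4,5,6,[0],[]), (0,2,4,5,7,[0],[]),
    (0,2,4,5,9,[0],[(4,7),(4,10),(4,12),(4,13),(5,10),(5,12),(5,13)]),
    (0,2,4,5,10,[0],[(5,9),(5,11),(5,12)]), (0,2,4,5,12,[0],[(5,9)]), (0,2,4,6,7,[0],[]),
    (0,2,4,6,8,[0],[]), (0,2,4,6,9,[0],[(6,10),(6,11)]), (0,2,4,7,8,[0],[]),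
    (0,2,4,7,9,[0],[(7,10),(7,11),(7,13)]), (0,2,4,7,10,[0],[(7,11),(7,12)]),
    (0,2,4,7,11,[0],[(7,9)]), (0,2,4,9,13,[0],[(4,11),(4,12)]), (0,2,4,11,12,[0],[(4,10)]),
    (0,2,4,12,13,[0],[(4,10),(4,11)]), (0,2,4,12,14,[0],[(4,10),(4,11)]),
    (0,2,4,13,15,[0],[(4,10)]), (0,2,4,13,16,[0],[(4,10)]), (0,2,5,6,7,[0],[]),
    (0,2,5,7,8,[0],[]), (0,2,5,7,9,[0],[(7,10),(7,11),(7,12),(7,13)]),
    (0,2,5,7,10,[0],[(7,11)]), (0,2,5,9,12,[0],[(5,11)]), (0,2,5,9,13,[0],[(5,12)]),
    (0,2,5,11,12,[0],[(5,9),(5,10)]), (0,2,5,12,13,[0],[(5,10),(5,11)]),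
    (0,2,5,12,14,[0],[(5,11),(5,13)]), (0,2,5,13,15,[0],[(5,12)]), (0,2,5,13,16,[0],[(5,12)]),
    (0,2,5,15,17,[0],[(5,9)]), (0,2,10,12,13,[0],[(10,11)]), (0,2,10,12,14,[0],[(10,11)]),
    (0,2,10,13,15,[0],[(10,12)]), (0,2,10,13,16,[0],[(10,12)]), (0,2,10,14,16,[0],[(10,12)]),
    (0,2,11,12,13,[0],[(2,10)]), (0,2,11,12,14,[0],[(2,10)]), (0,2,12,13,14,[0],[(2,11)]),
    (0,2,12,14,16,[0],[(2,11)]), (0,2,12,14,17,[0],[(2,11)]), (0,2,12,15,17,[0],[(2,11)]),
    (0,2,13,14,15,[0],[(2,11)]), (0,2,13,14,16,[0],[(2,11)]), (0,2,13,15,16,[0],[(2,11)]),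
    (0,2,13,15,17,[0],[(2,10),(2,11)]), (0,2,14,16,18,[0],[(2,11)]), (0,3,4,5,6,[0],[]),
    (0,3,4,5,7,[0],[]), (0,3,4,5,8,[0],[]),
    (0,3,4,5,9,[0],[(4,7),(4,8),(4,10),(4,11),(4,12),(4,13),(5,10),(5,11),(5,12),(5,13)]),
    (0,3,4,5,10,[0],[(4,11),(4,13),(5,9),(5,11),(5,12),(5,13)]), (0,3,4,5,12,[0],[(5,11)]),
    (0,3,4,6,7,[0],[]), (0,3,4,6,8,[0],[]), (0,3,4,6,10,[0],[(6,11),(6,12)]),
    (0,3,4,9,13,[0],[(4,12)]), (0,3,4,11,12,[0],[(4,9)]), (0,3,4,12,13,[0],[(4,11)]),
    (0,3,4,12,14,[0],[(4,11)]), (0,3,5,6,7,[0],[]), (0,3,5,6,8,[0],[]),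
    (0,3,5,6,9,[0],[(5,10)]), (0,3,5,6,10,[0],[(6,11),(6,12)]), (0,3,5,7,8,[0],[]),
    (0,3,5,7,9,[0],[(7,10),(7,11)]), (0,3,5,7,10,[0],[(7,9),(7,11),(7,12),(7,13),(7,14)]),
    (0,3,5,9,10,[0],[(9,11)]), (0,3,5,10,12,[0],[(5,11)]), (0,3,5,10,13,[0],[(5,11),(5,12)]),
    (0,3,5,10,14,[0],[(5,11)]), (0,3,5,11,12,[0],[(5,9),(5,10)]),
    (0,3,5,12,13,[0],[(5,10),(5,11)]), (0,3,5,12,14,[0],[(5,11)]), (0,3,6,7,8,[0],[]),
    (0,3,6,9,10,[0],[(9,11)]), (0,3,6,11,12,[0],[(6,9),(6,10)]),
    (0,3,6,12,13,[0],[(6,10),(6,11)]), (0,3,6,12,14,[0],[(6,10),(6,11)]),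
    (0,3,6,12,15,[0],[(6,11)]), (0,3,9,12,13,[0],[(9,11)]), (0,3,9,12,14,[0],[(9,11)]),
    (0,3,9,13,15,[0],[(3,10),(3,11)]), (0,3,9,13,16,[0],[(3,10),(3,11)]),
    (0,3,9,14,16,[0],[(3,11),(3,12)]), (0,3,10,12,13,[0],[(10,11)]),
    (0,3,10,12,14,[0],[(3,11),(10,11)]), (0,3,10,13,15,[0],[(10,12)]),
    (0,3,10,13,16,[0],[(10,12)]), (0,3,11,12,13,[0],[(3,9),(3,10)]),
    (0,3,11,12,14,[0],[(3,10)]), (0,3,12,13,14,[0],[(3,11)]),
    (0,3,12,14,16,[0],[(3,10),(3,11)]), (0,3,12,14,17,[0],[(3,10),(3,11)]),
    (0,3,12,15,17,[0],[(3,9),(3,10),(3,11)]), (0,3,13,15,17,[0],[(3,9),(3,10),(3,11)]),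
    (0,4,5,6,7,[0],[]), (0,4,5,6,8,[0],[]), (0,4,5,6,9,[0],[(5,8),(5,10),(5,11),(6,11),(6,13)]),
    (0,4,5,6,10,[0],[(6,11),(6,12),(6,13)]), (0,4,5,6,14,[0],[(6,12)]), (0,4,5,7,8,[0],[]),
    (0,4,5,12,13,[0],[(5,10),(5,11)]), (0,4,5,12,14,[0],[(5,10),(5,11)]),
    (0,4,5,13,15,[0],[(5,10)]), (0,4,5,13,16,[0],[(5,10)]), (0,4,6,7,8,[0],[]),
    (0,4,6,9,10,[0],[(9,11)]), (0,4,6,9,13,[0],[(6,10),(6,11)]), (0,4,6,10,12,[0],[(10,11)]),
    (0,4,6,11,12,[0],[(6,9),(6,10)]), (0,4,6,12,13,[0],[(6,11)]),
    (0,4,6,12,14,[0],[(6,11),(6,13)]), (0,4,6,15,17,[0],[(6,9)]),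
    (0,4,9,12,13,[0],[(4,11),(9,11)]), (0,4,9,12,14,[0],[(4,11),(9,11)]),
    (0,4,9,13,15,[0],[(4,11)]), (0,4,9,13,16,[0],[(4,12)]), (0,4,9,14,16,[0],[(4,12),(9,12)]),
    (0,4,11,12,13,[0],[(4,10)]), (0,4,11,12,14,[0],[(4,10)]), (0,4,12,13,14,[0],[(4,10)]),
    (0,4,12,14,17,[0],[(4,10)]), (0,4,12,15,17,[0],[(4,10),(4,11)]),
    (0,4,13,15,17,[0],[(4,10),(4,11)]), (0,5,6,7,8,[0],[]),
    (0,5,6,7,10,[0],[(7,12),(7,13),(7,14)]), (0,5,6,14,16,[0],[(6,10)]),
    (0,5,7,8,10,[0],[(8,11)]), (0,5,7,9,10,[0],[(9,11)]), (0,5,7,11,12,[0],[(7,10)]),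
    (0,5,9,14,16,[0],[(5,10)]), (0,5,10,12,13,[0],[(10,11)]), (0,5,13,15,17,[0],[(5,10)]),
    (0,6,7,8,10,[0],[(8,9),(8,11),(8,12),(8,13),(8,17),(10,17)]), (0,6,9,14,16,[0],[(6,10)]),
    (0,6,13,15,17,[0],[(6,10)]), (0,9,10,11,13,[0],[(11,12)]), (0,9,10,12,13,[0],[(10,11)]),
    (0,9,10,12,14,[0],[(10,11)]), (0,9,10,13,15,[0],[(10,12),(10,14)]),
    (0,9,10,13,16,[0],[(10,12),(10,14)]), (0,9,10,14,16,[0],[(10,12)]),
    (0,9,11,12,13,[0],[(9,10)]), (0,9,11,12,14,[0],[(9,10)]), (0,9,12,13,14,[0],[(9,11)]),
    (0,9,12,14,16,[0],[(9,10),(9,11)]), (0,9,12,14,17,[0],[(9,10),(9,11)]),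
    (0,9,12,15,17,[0],[(9,10),(9,11)]), (0,9,13,14,15,[0],[(9,11)]),
    (0,9,13,14,16,[0],[(9,11)]), (0,9,13,15,16,[0],[(9,11)]),
    (0,9,13,15,17,[0],[(9,10),(9,11),(9,12),(9,18),(13,18)]), (0,9,14,15,16,[0],[(9,11)]),
    (0,9,14,16,18,[0],[(9,11)]), (0,10,11,12,13,[0],[(10,18),(11,14)]),
    (0,10,11,12,14,[0],[(10,18)]), (0,10,12,13,14,[0],[(10,11)]),
    (0,10,12,14,16,[0],[(10,11),(10,13),(10,15),(12,15)]),
    (0,10,12,14,17,[0],[(10,11),(10,13),(10,15),(10,16),(12,15),(12,16)]),
    (0,10,12,15,17,[0],[(10,11),(10,13)]), (0,10,13,14,15,[0],[(10,11),(10,12)]),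
    (0,10,13,14,16,[0],[(10,11),(10,12)]), (0,10,13,15,16,[0],[(10,11),(10,12),(10,14)]),
    (0,10,13,15,17,[0],[(10,11),(10,12)]), (0,10,13,15,18,[0],[(10,11)]),
    (0,10,13,16,18,[0],[(10,11)]), (0,10,14,15,16,[0],[(10,11),(10,12)]),
    (0,10,14,15,17,[0],[(10,12)]), (0,10,14,16,17,[0],[(10,12)]),
    (0,10,14,16,18,[0],[(10,11),(10,12)]), (0,10,15,16,17,[0],[(10,12)]),
    (0,11,12,13,14,[0],[]), (0,11,12,13,15,[0],[]), (0,11,12,13,16,[0],[]),
    (0,11,12,14,15,[0],[]), (0,11,12,14,16,[0],[]), (0,11,12,14,17,[0],[]),
    (0,11,12,15,17,[0],[]), (0,11,13,14,15,[0],[]), (0,11,13,14,16,[0],[]),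
    (0,11,13,15,16,[0],[]), (0,11,13,15,17,[0],[]), (0,11,13,15,18,[0],[]),
    (0,11,13,16,18,[0],[]), (0,11,14,15,16,[0],[]), (0,11,14,16,18,[0],[]),
    (0,12,13,14,15,[0],[]), (0,12,13,14,16,[0],[]), (0,12,13,15,16,[0],[]),
    (0,12,13,15,17,[0],[]), (0,12,14,15,16,[0],[]), (0,12,14,15,17,[0],[]),
    (0,12,14,16,17,[0],[]), (0,12,14,16,18,[0],[]), (0,12,15,16,17,[0],[]),
    (0,12,15,17,18,[0],[]), (0,13,14,15,16,[0],[]), (0,13,14,15,17,[0],[]),
    (0,13,14,16,17,[0],[]), (0,13,14,16,18,[0],[]), (0,13,15,16,17,[0],[]),
    (0,13,15,16,18,[0],[]), (0,13,15,17,18,[0],[]), (0,13,16,17,18,[0],[]),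
    (0,14,15,16,17,[0],[]), (0,14,15,16,18,[0],[]), (0,14,15,17,18,[0],[]),
    (0,14,16,17,18,[0],[]), (0,15,16,17,18,[0],[]), (1,2,3,4,5,[2,3,5,6,7],[]),
    (1,2,3,4,6,[2,3,5,6,7],[]), (1,2,3,4,7,[6,7],[]), (1,2,3,4,8,[7],[]), (1,2,3,4,9,[1,7],[]),
    (1,2,3,4,10,[1,7],[(10,9)]), (1,2,3,4,11,[7],[(11,10)]), (1,2,3,5,6,[2,3,5,7],[]),
    (1,2,3,5,7,[5,6,7],[]), (1,2,3,5,8,[7],[]), (1,2,3,5,9,[1,7],[]),
    (1,2,3,5,10,[1,7],[(10,9)]), (1,2,3,5,11,[7],[(11,10)]), (1,2,3,6,8,[7],[]),
    (1,2,3,6,9,[7],[]), (1,2,3,6,10,[7],[(10,9)]), (1,2,3,6,11,[7],[(11,10)]),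
    (1,2,3,6,18,[7],[(18,10)]), (1,2,3,7,8,[7],[]), (1,2,3,7,9,[7],[]),
    (1,2,3,7,10,[7],[(10,9)]), (1,2,3,7,11,[7],[(11,10)]), (1,2,3,8,9,[7],[]),
    (1,2,3,8,10,[7],[(10,9)]), (1,2,3,8,11,[7],[(11,10)]), (1,2,3,8,18,[7],[(18,10)]),
    (1,2,4,5,6,[2,5,6],[]), (1,2,4,5,7,[3,5],[]), (1,2,4,5,9,[1],[]), (1,2,4,5,10,[1],[(10,9)]),
    (1,2,4,6,7,[3,7],[]), (1,2,4,6,8,[6,7],[]), (1,2,4,7,8,[7],[]), (1,2,4,8,9,[7],[]),
    (1,2,4,8,10,[7],[(10,9)]), (1,2,4,8,11,[7],[(11,10)]), (1,2,4,8,18,[7],[(18,10)]),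
    (1,2,5,6,7,[7],[]), (1,2,5,7,8,[7],[]), (1,2,5,8,9,[7],[]), (1,2,5,8,10,[7],[(10,9)]),
    (1,2,5,8,11,[7],[(11,10)]), (1,2,5,8,18,[7],[(18,10)]), (1,2,6,7,8,[7],[]),
    (1,2,6,8,9,[7],[]), (1,2,6,8,10,[7],[(10,9)]), (1,2,6,8,11,[7],[(11,10)]),
    (1,2,6,8,18,[7],[(18,10)]), (1,2,7,8,9,[7],[]), (1,2,7,8,10,[7],[(10,9)]),
    (1,2,7,8,11,[7],[(11,10)]), (1,2,7,8,18,[7],[(18,10)]), (1,2,8,9,10,[7],[(10,5)]),
    (1,2,8,9,11,[7],[(11,10)]), (1,2,8,9,12,[7],[(12,10)]), (1,2,8,9,14,[7],[(9,7),(14,7)]),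
    (1,2,8,10,11,[7],[(10,7),(11,7)]), (1,3,4,5,6,[2,3,5,6,7],[]), (1,3,4,5,7,[7],[]),
    (1,3,4,5,9,[1],[]), (1,3,4,5,10,[1],[(10,9)]), (1,3,4,6,8,[5,6],[]), (1,3,5,6,7,[7],[]),
    (1,3,5,6,8,[3,5],[]), (1,3,5,7,8,[3,7],[]), (1,3,5,9,11,[0],[(11,10)]), (1,3,6,7,8,[7],[]),
    (1,3,6,9,11,[0],[(11,10)]), (1,3,6,9,18,[0],[(18,10)]), (1,3,7,8,9,[3,7],[]),
    (1,3,7,8,10,[7],[(10,9)]), (1,3,7,8,11,[7],[(11,10)]), (1,3,7,8,18,[7],[(18,10)]),
    (1,3,8,9,10,[7],[(10,7)]), (1,3,8,9,11,[7],[(11,10)]), (1,3,8,9,18,[7],[(18,10)]),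
    (1,3,8,10,11,[7],[(10,7),(11,7)]), (1,4,5,6,7,[7],[]), (1,4,6,7,8,[7],[]),
    (1,4,6,9,11,[0],[(11,10)]), (1,4,7,8,9,[3,7],[]), (1,4,7,8,10,[7],[(10,9)]),
    (1,4,7,8,11,[7],[(11,10)]), (1,4,7,8,18,[7],[(18,10)]), (1,4,8,9,10,[7],[(10,5)]),
    (1,4,8,9,11,[7],[(11,10)]), (1,4,8,9,18,[7],[(18,10)]), (1,4,8,10,11,[7],[(10,7),(11,7)]),
    (1,5,6,7,8,[7],[]), (1,5,7,8,9,[3,7],[]), (1,5,7,8,10,[7],[(10,9)]),
    (1,5,7,8,11,[7],[(11,10)]), (1,5,7,8,18,[7],[(18,10)]), (1,5,8,9,10,[7],[(9,7),(10,4)]),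
    (1,5,8,9,11,[7],[(11,10)]), (1,5,8,9,18,[7],[(18,10)]), (1,5,8,10,11,[7],[(10,7),(11,7)]),
    (1,6,7,8,9,[3,7],[]), (1,6,7,8,10,[7],[(10,9)]), (1,6,7,8,11,[7],[(8,4),(11,10)]),
    (1,6,8,9,10,[7],[(9,7),(10,4)]), (1,6,8,9,11,[7],[(11,10)]),
    (1,6,8,10,11,[7],[(10,7),(11,7)]), (1,6,8,11,18,[7],[(11,4)]), (1,6,8,12,14,[7],[(12,11)]),
    (1,7,8,9,10,[7],[(9,6),(10,6)]), (1,7,8,9,11,[7],[(11,10)]), (1,7,8,9,18,[7],[(18,10)]),
    (1,7,8,10,11,[7],[(10,6),(11,6)]), (1,7,8,11,18,[7],[(8,5),(11,5),(11,6)]),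
    (1,8,9,10,11,[7],[(10,5),(10,6),(11,5),(11,6)]), (1,8,9,11,12,[7],[(12,10)]),
    (1,8,9,11,18,[7],[(11,5),(11,6),(11,7)]), (1,8,11,12,14,[7],[(12,10)]),
    (1,9,11,17,18,[7],[(9,8)]), (1,9,12,13,15,[5],[(1,11)]), (2,3,4,5,6,[2,3,5,6,7],[]),
    (2,3,4,5,7,[2,3,5,6,7],[]), (2,3,4,5,8,[7],[]), (2,3,4,5,9,[1],[]),
    (2,3,4,5,10,[1],[(10,9)]), (2,3,4,5,11,[1],[(11,9),(11,10)]), (2,3,4,6,7,[2,3,5,7],[]),
    (2,3,4,6,8,[7],[]), (2,3,4,6,9,[1],[]), (2,3,4,6,10,[1],[(10,9)]),
    (2,3,4,6,11,[1],[(11,10)]), (2,3,4,7,8,[7],[]), (2,3,4,9,11,[0],[(11,10)]),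
    (2,3,4,10,11,[0],[(11,1),(11,9)]), (2,3,5,6,7,[2,5,6,7],[]), (2,3,5,6,9,[1],[]),
    (2,3,5,6,10,[1],[(10,9)]), (2,3,5,6,11,[1],[(11,10)]), (2,3,5,7,8,[6,7],[]),
    (2,3,5,9,11,[0],[(11,10)]), (2,3,5,10,11,[0],[(11,9)]), (2,4,5,6,7,[2,3,5,6,7],[]),
    (2,4,5,6,8,[7],[]), (2,4,5,6,9,[1],[]), (2,4,5,6,10,[1],[(10,9)]),
    (2,4,5,6,11,[1],[(11,9)]), (2,4,5,7,8,[5,6],[]), (2,4,5,9,11,[0],[(11,10)]),
    (2,4,5,10,11,[0],[(11,1),(11,9)]), (2,4,6,7,8,[3,5,7],[]), (2,4,6,8,9,[7],[]),
    (2,4,6,8,10,[7],[(10,9)]), (2,4,6,8,11,[7],[(11,10)]), (2,4,6,8,18,[7],[(18,10)]),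
    (2,4,6,9,11,[0,4],[(11,10)]), (2,4,6,9,18,[0],[(18,10)]), (2,4,6,10,11,[0,4],[(11,9)]),
    (2,4,7,9,11,[0,4],[(11,10)]), (2,4,7,9,18,[0],[(18,10)]), (2,4,7,10,11,[0,4],[(11,9)]),
    (2,5,6,7,8,[3,7],[]), (2,5,6,10,11,[0],[(11,4)]), (2,5,7,9,11,[0,4],[(11,10)]),
    (2,5,7,9,18,[0],[(18,10)]), (2,5,7,10,11,[4],[(11,9)]), (2,6,7,8,9,[3],[]),
    (2,6,7,8,10,[3],[(10,9)]), (2,6,7,8,11,[3],[(11,10)]), (2,6,7,8,14,[7],[(7,4)]),
    (3,4,5,6,7,[2,3,5,6,7],[]), (3,4,5,6,8,[2,3,5,6,7],[]), (3,4,5,6,9,[1,2],[]),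
    (3,4,5,6,10,[1,2],[(10,9)]), (3,4,5,6,11,[1],[(11,10)]), (3,4,5,7,8,[2,3,5],[]),
    (3,4,5,7,9,[1,2],[]), (3,4,5,7,10,[1,2],[(10,2),(10,9)]), (3,4,5,9,10,[0],[(10,2)]),
    (3,4,5,9,11,[0],[(11,2),(11,10)]), (3,4,5,10,11,[0],[(11,1),(11,9)]),
    (3,4,6,7,8,[2,5,6,7],[]), (3,4,6,7,9,[1,2],[]), (3,4,6,7,10,[1,2],[(10,2),(10,9)]),
    (3,4,6,7,11,[1],[(11,10)]), (3,4,6,8,9,[6,7],[]), (3,4,6,8,10,[6,7],[(10,9)]),
    (3,4,6,8,11,[6,7],[(11,10)]), (3,4,6,9,10,[0],[(10,2)]), (3,4,6,9,11,[0],[(11,10)]),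
    (3,4,6,10,11,[0],[(11,1)]), (3,4,9,10,11,[0],[(11,2)]), (3,5,6,7,8,[2,3,5,6,7],[]),
    (3,5,6,7,9,[1,2,3],[]), (3,5,6,7,10,[1,2,3],[(10,9)]), (3,5,6,8,9,[5,6],[]),
    (3,5,6,8,10,[5,6],[(10,9)]), (3,5,6,8,11,[5,6],[(11,10)]), (3,5,6,8,18,[5],[(18,10)]),
    (3,5,6,9,10,[0],[(10,2)]), (3,5,6,9,11,[0],[(11,10)]), (3,5,6,10,11,[0],[(11,1),(11,4)]),
    (3,5,7,8,9,[3,5],[]), (3,5,7,8,10,[3,5],[(10,9)]), (3,5,7,8,11,[3,5],[(11,10)]),
    (3,5,7,9,11,[4],[(11,10)]), (3,5,7,10,11,[4],[(11,9)]), (3,5,9,10,11,[0],[(11,2)]),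
    (3,5,9,12,13,[2],[(5,10)]), (3,5,10,11,12,[0],[(12,2)]), (3,5,10,12,13,[6],[(5,11)]),
    (3,6,7,8,9,[3],[]), (3,6,7,8,10,[3],[(10,9)]), (3,6,7,8,11,[3],[(11,10)]),
    (3,6,7,8,18,[7],[(7,4)]), (3,7,8,9,10,[5],[(9,6),(10,6)]), (3,7,8,9,11,[5],[(11,10)]),
    (3,7,8,9,18,[5],[(18,10)]), (3,7,8,10,11,[5],[(10,5),(10,6),(11,5),(11,6),(11,9)]),
    (3,7,8,11,12,[1],[(12,5)]), (3,8,11,12,13,[0],[(13,7)]), (3,9,12,13,14,[5],[(3,11)]),
    (3,9,12,13,15,[5],[(3,10),(3,11)]), (3,9,12,14,15,[5],[(3,11),(3,13)]),
    (4,5,6,7,8,[2,3,5,6,7],[]), (4,5,6,7,9,[1,2,3],[]), (4,5,6,7,10,[1,2,3],[(10,3),(10,9)]),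
    (4,5,6,7,11,[1],[(11,10)]), (4,5,6,8,9,[2],[]), (4,5,6,8,10,[2],[(10,9)]),
    (4,5,6,8,11,[2],[(11,10)]), (4,5,6,9,10,[0,1],[(10,2),(10,3)]),
    (4,5,6,9,11,[0],[(11,2),(11,10)]), (4,5,6,10,11,[0,1],[(11,2),(11,3),(11,9)]),
    (4,5,7,8,9,[1,2,3],[]), (4,5,7,8,10,[1,2,3],[(10,9)]), (4,5,7,8,11,[2,3],[(11,10)]),
    (4,5,7,9,10,[0,1,4],[(9,3),(10,2),(10,3)]), (4,5,7,9,11,[0,1,4],[(11,2),(11,3),(11,10)]),
    (4,5,7,10,11,[0,1,4],[(10,3),(11,2),(11,3),(11,9)]), (4,5,7,10,12,[0,5],[(7,11),(12,3)]),
    (4,5,7,11,12,[0],[(12,10)]), (4,5,9,10,11,[0],[(11,2),(11,3)]), (4,5,9,11,12,[0],[(12,3)]),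
    (4,5,10,11,12,[0],[(12,3)]), (4,5,10,11,13,[0],[(13,3)]), (4,5,10,12,13,[3],[(4,11)]),
    (4,6,7,8,9,[1,2,3],[]), (4,6,7,8,10,[1,2,3],[(10,9)]), (4,6,7,8,11,[2,3],[(11,10)]),
    (4,6,7,8,14,[7],[(7,3)]), (4,6,7,8,18,[7],[(18,10)]),
    (4,6,7,9,10,[0,1,4],[(9,2),(10,2),(10,3)]), (4,6,7,9,11,[0,1,4],[(11,2),(11,10)]),
    (4,6,7,9,18,[1],[(18,10)]), (4,6,7,10,11,[0,1,4],[(10,3),(11,2),(11,3),(11,9)]),
    (4,6,9,12,13,[3,6],[(4,10),(6,11)]), (4,6,10,11,12,[0],[(12,3)]),
    (4,6,10,11,13,[0],[(13,3)]), (4,7,8,9,10,[5],[(9,6),(10,6)]), (4,7,8,9,11,[5],[(11,10)]),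
    (4,7,8,9,18,[5],[(18,10)]), (4,7,8,10,11,[5],[(10,5),(10,6),(11,3),(11,9)]),
    (4,7,8,11,12,[1],[(12,5)]), (4,8,11,12,13,[0],[(13,7)]), (4,9,12,13,14,[5],[(4,11)]),
    (4,9,12,13,15,[5],[(4,11)]), (4,9,12,14,15,[5],[(4,11),(4,13)]), (5,6,7,8,9,[1,2,3,7],[]),
    (5,6,7,8,10,[1,2,3],[(10,9)]), (5,6,7,8,11,[2,3],[(11,10)]), (5,6,7,8,18,[7],[(7,3)]),
    (5,6,7,9,10,[0,1,4,5],[(7,13),(9,2),(9,3),(9,4),(10,2),(10,3),(10,4)]),
    (5,6,7,9,11,[0,1,4],[(9,3),(11,2),(11,3),(11,4),(11,10)]), (5,6,7,9,18,[1],[(18,10)]),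
    (5,6,7,10,11,[0,1,4],[(10,3),(10,4),(11,2),(11,3),(11,4),(11,9)]),
    (5,6,7,10,12,[0],[(12,3),(12,4)]), (5,6,7,11,12,[0],[(12,10)]), (5,6,7,11,13,[0],[(13,10)]),
    (5,6,8,9,10,[1],[(10,4)]), (5,6,8,9,11,[1],[(11,10)]), (5,6,8,10,11,[1],[(11,4),(11,9)]),
    (5,6,9,10,11,[0,4],[(10,3),(11,1),(11,3)]), (5,6,9,10,13,[3],[(5,12)]),
    (5,6,9,11,12,[0],[(12,3),(12,4)]), (5,6,9,12,13,[3],[(5,10),(5,11)]),
    (5,6,10,11,12,[0],[(12,3),(12,4)]), (5,6,10,11,13,[0],[(13,3)]),
    (5,6,10,12,13,[0],[(13,4)]), (5,7,8,9,10,[0,1,4,5],[(9,3),(9,6),(10,3),(10,4)]),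
    (5,7,8,9,11,[0,1,4,5],[(9,3),(11,3),(11,10)]), (5,7,8,9,18,[5],[(18,10)]),
    (5,7,8,10,11,[0,1,4,5],[(5,1),(5,2),(10,1),(10,2),(10,3),(10,4),(10,6),(11,3),(11,4),(11,9)]),
    (5,7,8,11,12,[0,1],[(12,10)]), (5,7,9,10,11,[0,4],[(10,3),(11,1),(11,2),(11,3),(11,4)]),
    (5,7,9,11,12,[0],[(12,4),(12,10)]), (5,7,10,11,12,[0],[(12,3),(12,4)]),
    (5,7,10,11,13,[0],[(13,3),(13,6)]), (5,7,10,12,13,[0],[(13,4)]),
    (5,9,12,14,15,[5],[(5,10)]),
    (6,7,8,9,10,[0,1,4,5],[(9,3),(9,4),(9,5),(10,1),(10,3),(10,4),(10,5)]),
    (6,7,8,9,11,[0,1,4,5],[(9,4),(11,3),(11,4),(11,5),(11,10)]), (6,7,8,9,18,[0,4,5],[(18,10)]),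
    (6,7,8,10,11,[0,1,4,5],[(6,3),(10,3),(10,4),(10,5),(11,3),(11,4),(11,5),(11,9)]),
    (6,7,8,11,12,[0,5],[(12,10)]),
    (6,7,9,10,11,[0,4],[(10,3),(10,4),(10,5),(11,1),(11,3),(11,4),(11,5)]),
    (6,7,9,10,12,[2],[(9,4)]), (6,7,9,11,12,[0],[(12,3),(12,4),(12,5),(12,10)]),
    (6,7,10,11,12,[0,2],[(6,1),(10,4),(12,1),(12,2),(12,3),(12,4),(12,5)]),
    (6,7,10,11,13,[0],[(13,4),(13,5)]), (6,7,10,12,13,[0],[(13,4),(13,5)]),
    (6,7,11,12,13,[0],[(13,4),(13,5)]), (6,8,9,10,11,[2,4],[(9,4),(11,2),(11,4)]),
    (6,8,10,11,12,[0,2],[(10,4),(12,3),(12,4)]), (6,9,11,12,13,[0],[(13,5)]),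
    (6,9,12,14,15,[5],[(6,10)]), (6,10,11,12,13,[4],[(12,5),(12,9)]),
    (6,10,12,13,15,[4],[(13,5)]),
    (7,8,9,10,11,[0,2,4,6],[(9,4),(9,5),(10,4),(10,5),(10,6),(11,2),(11,3),(11,4),(11,5),(11,6)]),
    (7,8,9,11,12,[0,4],[(11,10),(12,5),(12,6),(12,10)]), (7,8,9,11,13,[4],[(11,10),(13,10)]),
    (7,8,9,11,18,[6],[(9,4),(9,5),(11,4),(11,5),(11,6)]),
    (7,8,10,11,12,[0,2],[(10,4),(10,5),(12,3),(12,4),(12,5)]),
    (7,8,10,11,13,[0],[(13,3),(13,4),(13,5)]),
    (7,8,10,11,18,[6],[(7,3),(7,4),(10,3),(10,4),(10,5),(10,6)]), (7,8,11,12,14,[6],[(12,10)]),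
    (7,9,10,11,12,[2],[(10,5)]), (7,9,11,12,13,[0,4],[(12,5),(12,6),(13,4),(13,5),(13,6)]),
    (7,10,11,12,13,[0,4],[(12,6),(13,5),(13,6)]), (8,9,11,12,13,[0],[(13,7)]),
    (8,9,11,12,14,[0,7],[(12,10),(14,7),(14,10)]), (8,9,11,12,18,[7],[(11,10)]),
    (8,9,11,13,14,[7],[(13,10)]), (8,9,11,13,15,[7],[(13,10)]), (8,9,14,17,18,[7],[(14,11)]),
    (8,10,11,12,13,[0,4],[(12,7),(13,7)]), (8,10,11,12,18,[7],[(11,9),(12,9),(18,9),(18,13)]),
    (8,11,12,13,18,[7],[(12,10)]), (8,11,12,14,15,[7],[(11,9),(14,10)]),
    (8,11,12,14,16,[7],[(11,9),(14,10)]), (8,11,13,17,18,[7],[(11,9)]),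
    (9,11,12,13,14,[3],[(11,7),(12,7)]), (9,11,12,13,18,[7],[(11,7),(12,7),(12,10)]),
    (9,11,12,14,15,[7],[(11,7),(11,8)]), (9,11,12,14,16,[7],[(11,7),(11,8)]),
    (9,11,12,14,18,[7],[(12,6),(12,7)]), (9,11,12,15,18,[7],[(12,7),(12,8)]),
    (9,11,12,16,18,[7],[(12,6),(12,7)]),
    (9,11,13,15,16,[3,7],[(13,10),(15,10),(15,12),(16,10),(16,12)]),
    (9,11,13,15,17,[7],[(13,10),(15,10),(15,12)]),
    (9,11,13,17,18,[7],[(11,8),(13,8),(17,8),(17,10)]), (9,11,14,17,18,[7],[(11,7),(11,8)]),
    (10,11,12,13,14,[2,4],[]), (10,11,12,13,15,[2,4],[]), (10,11,12,13,17,[6],[]),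
    (10,11,12,13,18,[6,7],[]), (10,11,12,14,15,[2,4,6,7],[]), (10,11,12,14,16,[5,6,7],[]),
    (10,11,12,14,18,[6,7],[]), (10,11,12,15,18,[6,7],[]), (10,11,12,16,18,[6,7],[]),
    (10,11,12,17,18,[7],[]), (10,11,13,14,15,[2],[]), (10,11,13,14,16,[3,5],[]),
    (10,11,13,15,16,[3,7],[]), (10,11,13,15,17,[7],[]), (10,11,13,17,18,[7],[]),
    (10,11,14,17,18,[7],[]), (10,11,15,17,18,[7],[]), (10,11,16,17,18,[7],[]),
    (10,12,13,14,15,[2,4,6],[]), (10,12,13,14,16,[2,4,6],[]), (10,12,13,15,16,[2,4],[]),
    (10,12,14,15,16,[2,4],[]), (10,12,16,17,18,[7],[]), (10,13,14,15,16,[2],[]),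
    (10,13,16,17,18,[7],[]), (10,14,15,16,17,[4],[]), (10,14,16,17,18,[7],[]),
    (10,15,16,17,18,[7],[]), (11,12,13,14,15,[2,3,5,6,7],[]), (11,12,13,14,16,[2,3,5,6,7],[]),
    (11,12,13,14,17,[6,7],[]), (11,12,13,14,18,[7],[]), (11,12,13,15,16,[2,3,5,7],[]),
    (11,12,13,15,17,[5,6,7],[]), (11,12,13,15,18,[7],[]), (11,12,13,16,18,[7],[]),
    (11,12,13,17,18,[7],[]), (11,12,14,15,16,[2,5,6],[]), (11,12,14,15,17,[3,5],[]),
    (11,12,14,16,17,[3,7],[]), (11,12,14,16,18,[6,7],[]), (11,12,14,17,18,[7],[]),
    (11,12,15,16,17,[7],[]), (11,12,15,17,18,[7],[]), (11,12,16,17,18,[7],[]),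
    (11,13,14,15,16,[2,3,5,6,7],[]), (11,13,14,15,17,[7],[]), (11,13,14,16,18,[6],[]),
    (11,13,15,16,17,[7],[]), (11,13,15,17,18,[3,7],[]), (11,13,16,17,18,[7],[]),
    (11,14,15,16,17,[7],[]), (11,14,16,17,18,[7],[]), (11,15,16,17,18,[7],[]),
    (12,13,14,15,16,[2,3,5,6,7],[]), (12,13,14,15,17,[2,3,5,6,7],[]), (12,13,14,15,18,[7],[]),
    (12,13,14,16,17,[2,3,5,7],[]), (12,13,15,16,17,[2,5,6,7],[]), (12,13,15,17,18,[6,7],[]),
    (12,14,15,16,17,[2,3,5,6,7],[]), (12,14,15,17,18,[5,6],[]), (12,14,16,17,18,[3,5,7],[]),
    (12,15,16,17,18,[3,7],[]), (13,14,15,16,17,[2,3,5,6,7],[]), (13,14,15,16,18,[2,5],[]),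
    (13,14,15,17,18,[2],[]), (13,14,16,17,18,[2,6,7],[]), (13,15,16,17,18,[2,3,5,6,7],[]),
    (14,15,16,17,18,[2,3,5,6,7],[])
  ]"]
  note pen1 =
    pen0[THEN list_all_evens, simplified split_rules] pen0[THEN list_all_odds, simplified split_rules]
  note pen2 =
    pen1[THEN list_all_evens, simplified split_rules] pen1[THEN list_all_odds, simplified split_rules]
  note pen3 =
    pen2[THEN list_all_evens, simplified split_rules] pen2[THEN list_all_odds, simplified split_rules]
  note pen4 =
    pen3[THEN list_all_evens, simplified split_rules] pen3[THEN list_all_odds, simplified split_rules]
  note pen5 =
    pen4[THEN list_all_evens, simplified split_rules] pen4[THEN list_all_odds, simplified split_rules]
  note pen6 =
    pen5[THEN list_all_evens, simplified split_rules] pen5[THEN list_all_odds, simplified split_rules]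
  note pen7 =
    pen6[THEN list_all_evens, simplified split_rules] pen6[THEN list_all_odds, simplified split_rules]
  note pen8 =
    pen7[THEN list_all_evens, simplified split_rules] pen7[THEN list_all_odds, simplified split_rules]
  note pen9 =
    pen8[THEN list_all_evens, simplified split_rules] pen8[THEN list_all_odds, simplified split_rules]
  \<comment> \<open>For five points within one of the four sets of nine, \<open>windows\<close> replaces the hole by \<open>False\<close>.\<close>
  note pens = pen9[simplified clause_rules certificate_clauses_def left_or_first_def sorted_ccw_def windows]
  note seps = separation_list[of "[
    (1,5), (1,6), (1,10), (1,11), (1,12), (2,5), (2,9), (2,10), (2,11), (2,12), (3,6), (3,7),
    (3,9), (3,10), (3,11), (3,12), (3,13), (4,7), (4,8), (4,9), (4,10), (4,11), (4,12), (4,13),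
    (5,8), (5,9), (5,10), (5,11), (5,12), (5,13), (6,9), (6,10), (6,11), (6,12), (6,13), (7,9),
    (7,10), (7,11), (7,12), (7,13), (7,14), (8,9), (8,11), (8,12), (8,13), (8,17), (9,10),
    (9,11), (9,12), (9,18), (10,11), (10,12), (10,13), (10,14), (10,15), (10,16), (10,17),
    (10,18), (11,12), (11,14), (12,15), (12,16), (13,18)
  ]", simplified clause_rules separation_clauses_def]
  show False using quads tris pens seps by argo
qed

theorem theorem2:
  fixes S :: "(real^2) set"
  assumes "general_position S" and "card S = 19"
  shows "\<exists>H H'. hole 5 S H \<and> hole 5 S H' \<and> disjoint_holes H H'"
  using fan_exists[OF assms] two_disjoint_holes_fan by auto

end
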